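(* Let $A$ be a $C^*$-algebra and $M$ a Hilbert $C^*$-module over $A$. Then $\widetilde M\subset M'$ is a Hilbert $C^*$-module over $A$ with the inner product $\langle\cdot,\cdot\rangle$, and this inner product extends the inner product on $M$. This extension of the inner product is unique: any $A$-valued inner product on $\widetilde M$ that coincides on $M$ with the inner product of $M$ and whose induced norm equals the norm of $M'$ coincides with $\langle\cdot,\cdot\rangle$.
   Context: Hilbert $C^*$-modules are right modules with inner product $A$-linear in the second variable. $M'$ is the set of bounded anti-linear maps $f:M\to A$ with $f(ma)=a^*f(m)$ for $a\in A$, $m\in M$; it is a Banach space with norm $\|f\|_{M'}=\sup_{\|m\|\le 1}\|f(m)\|$ and a right $A$-module via $(fa)(m)=f(m)a$. $M$ is identified with a submodule of $M'$ via the isometric inclusion $m\mapsto\langle\cdot,m\rangle$. A closed right ideal $J\subset A$ is essential if $J\cap I\neq 0$ for every non-zero (not necessarily closed) right ideal $I\subset A$. For $f\in M'$ write $fJ\subset M$ if $fx\in M$ for all $x\in J$. Let $M_1$ be the set of all $f\in M'$ for which there is an essential closed right ideal $J$ of $A$ with $fJ\subset M$. For $f,g\in M_1$ and an essential closed right ideal $J$ with $fJ,gJ\subset M$, let $B^{f,g}(x,y)=(fy)(gx)\in A$ for $x\in J$, $y\in A$ (the functional $fy\in M'$ evaluated at $gx\in M$), and for $a\in A$ let $\iota(a)$ be the map $(x,y)\mapsto x^*ay$ on $J\times A$. The map $\iota$ is injective. Let $M_0=\{f\in M_1: B^{f,g}\in\iota(A)\ \forall g\in M_1\}$; this does not depend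 on the choice of $J$. Let $\widetilde M=\overline{M_0}$ be the norm closure of $M_0$ in $M'$. For $f,g\in M_0$ set $\langle g,f\rangle=a$, where $a\in A$ is the unique element (independent of $J$) with $\iota(a)=B^{f,g}$; the inner product on $\widetilde M$ is the extension by continuity of $\langle\cdot,\cdot\rangle$ from $M_0$. *)

theory Defs
  imports Complex_Main "HOL-Library.Function_Algebras"
begin

section \<open>Complex vector spaces and C*-algebras\<close>

class complex_vector = ab_group_add +
  fixes scaleC :: "complex \<Rightarrow> 'a \<Rightarrow> 'a"  (infixr \<open>*\<^sub>C\<close> 75)
  assumes scaleC_add_right: "c *\<^sub>C (x + y) = c *\<^sub>C x + c *\<^sub>C y"
    and scaleC_add_left: "(c + d) *\<^sub>C x = c *\<^sub>C x + d *\<^sub>C x"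
    and scaleC_scaleC: "c *\<^sub>C d *\<^sub>C x = (c * d) *\<^sub>C x"
    and scaleC_one: "1 *\<^sub>C x = x"

text \<open>No unit is assumed, and the zero algebra is allowed.\<close>

class cstar_algebra = complex_vector + real_normed_algebra + banach +
  fixes star :: "'a \<Rightarrow> 'a"  (\<open>_\<^sup>\<star>\<close> [1000] 999)
  assumes scaleR_scaleC: "r *\<^sub>R x = complex_of_real r *\<^sub>C x"
    and mult_scaleC_left: "(c *\<^sub>C x) * y = c *\<^sub>C (x * y)"
    and mult_scaleC_right: "x * (c *\<^sub>C y) = c *\<^sub>C (x * y)"
    and norm_scaleC: "norm (c *\<^sub>C x) = cmod c * norm x"
    and star_star: "(x\<^sup>\<star>)\<^sup>\<star> = x"
    and star_add: "(x + y)\<^sup>\<star> = x\<^sup>\<star> + y\<^sup>\<star>"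
    and star_scaleC: "(c *\<^sub>C x)\<^sup>\<star> = cnj c *\<^sub>C x\<^sup>\<star>"
    and star_mult: "(x * y)\<^sup>\<star> = y\<^sup>\<star> * x\<^sup>\<star>"
    and cstar_identity: "norm (x\<^sup>\<star> * x) = (norm x)\<^sup>2"

definition positive :: "'a::cstar_algebra \<Rightarrow> bool" where
  "positive a \<longleftrightarrow> (\<exists>b. a = b\<^sup>\<star> * b)"

instantiation "fun" :: (type, complex_vector) complex_vector
begin

definition scaleC_fun :: "complex \<Rightarrow> ('a \<Rightarrow> 'b) \<Rightarrow> 'a \<Rightarrow> 'b" where
  "c *\<^sub>C f = (\<lambda>x. c *\<^sub>C f x)"

instance
  by standard
    (simp_all add: scaleC_fun_def fun_eq_iff scaleC_add_right scaleC_add_left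
      scaleC_scaleC scaleC_one)

end

definition complex_subspace :: "'v::complex_vector set \<Rightarrow> bool" where
  "complex_subspace S \<longleftrightarrow>
     0 \<in> S \<and> (\<forall>x\<in>S. \<forall>y\<in>S. x + y \<in> S) \<and> (\<forall>c. \<forall>x\<in>S. c *\<^sub>C x \<in> S)"

definition right_ideal :: "'a::cstar_algebra set \<Rightarrow> bool" where
  "right_ideal I \<longleftrightarrow> complex_subspace I \<and> (\<forall>x\<in>I. \<forall>a. x * a \<in> I)"

text \<open>The ideals \<open>I\<close> tested against \<open>J\<close> need not be closed.\<close>

definition essential_closed_right_ideal :: "'a::cstar_algebra set \<Rightarrow> bool" where
  "essential_closed_right_ideal J \<longleftrightarrow>
     right_ideal J \<and> closed J \<and> (\<forall>I. right_ideal I \<and> I \<noteq> {0} \<longrightarrow> J \<inter> I \<noteq> {0})"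


section \<open>Hilbert C*-modules\<close>

text \<open>
  Modules are carried by subsets of an ambient complex vector space, so that the same notion
  applies to a whole type and to a set of functionals.
\<close>

locale right_cstar_module =
  fixes S :: "'v::complex_vector set"
    and act :: "'v \<Rightarrow> 'a::cstar_algebra \<Rightarrow> 'v"
  assumes subspace: "complex_subspace S"
    and act_closed: "x \<in> S \<Longrightarrow> act x a \<in> S"
    and act_add_left: "x \<in> S \<Longrightarrow> y \<in> S \<Longrightarrow> act (x + y) a = act x a + act y a"
    and act_add_right: "x \<in> S \<Longrightarrow> act x (a + b) = act x a + act x b"
    and act_mult: "x \<in> S \<Longrightarrow> act x (a * b) = act (act x a) b"
    and act_scaleC_left: "x \<in> S \<Longrightarrow> act (c *\<^sub>C x) a = c *\<^sub>C act x a"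
    and act_scaleC_right: "x \<in> S \<Longrightarrow> act x (c *\<^sub>C a) = c *\<^sub>C act x a"

locale inner_product_cstar_module = right_cstar_module S act
  for S :: "'v::complex_vector set" and act :: "'v \<Rightarrow> 'a::cstar_algebra \<Rightarrow> 'v" +
  fixes ip :: "'v \<Rightarrow> 'v \<Rightarrow> 'a"
  assumes ip_add_right: "x \<in> S \<Longrightarrow> y \<in> S \<Longrightarrow> z \<in> S \<Longrightarrow> ip x (y + z) = ip x y + ip x z"
    and ip_scaleC_right: "x \<in> S \<Longrightarrow> y \<in> S \<Longrightarrow> ip x (c *\<^sub>C y) = c *\<^sub>C ip x y"
    and ip_act_right: "x \<in> S \<Longrightarrow> y \<in> S \<Longrightarrow> ip x (act y a) = ip x y * a"
    and ip_star: "x \<in> S \<Longrightarrow> y \<in> S \<Longrightarrow> (ip x y)\<^sup>\<star> = ip y x"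
    and ip_positive: "x \<in> S \<Longrightarrow> positive (ip x x)"
    and ip_definite: "x \<in> S \<Longrightarrow> ip x x = 0 \<Longrightarrow> x = 0"

definition ip_norm :: "('v \<Rightarrow> 'v \<Rightarrow> 'a::cstar_algebra) \<Rightarrow> 'v \<Rightarrow> real" where
  "ip_norm ip x = sqrt (norm (ip x x))"

locale hilbert_cstar_module = inner_product_cstar_module S act ip
  for S :: "'v::complex_vector set" and act :: "'v \<Rightarrow> 'a::cstar_algebra \<Rightarrow> 'v"
    and ip :: "'v \<Rightarrow> 'v \<Rightarrow> 'a" +
  assumes complete:
    "\<lbrakk>\<And>n. X n \<in> S;
      \<And>e. e > 0 \<Longrightarrow> \<exists>N. \<forall>m\<ge>N. \<forall>n\<ge>N. ip_norm ip (X m - X n) < e\<rbrakk>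
     \<Longrightarrow> \<exists>x\<in>S. (\<lambda>n. ip_norm ip (X n - x)) \<longlonglongrightarrow> 0"


section \<open>The dual module and the extension of a Hilbert C*-module\<close>

text \<open>
  From here on the Hilbert module \<open>M\<close> is a whole type \<open>'m\<close> with action \<open>act\<close> and
  inner product \<open>ip\<close>.  Addition and scalar multiplication of functionals are pointwise.
\<close>

definition dual_module ::
  "('m::complex_vector \<Rightarrow> 'a::cstar_algebra \<Rightarrow> 'm) \<Rightarrow> ('m \<Rightarrow> 'm \<Rightarrow> 'a) \<Rightarrow> ('m \<Rightarrow> 'a) set" where
  "dual_module act ip = {f.
     (\<forall>m n. f (m + n) = f m + f n) \<and>
     (\<forall>c m. f (c *\<^sub>C m) = cnj c *\<^sub>C f m) \<and>
     (\<forall>m a. f (act m a) = a\<^sup>\<star> * f m) \<and>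
     (\<exists>K. \<forall>m. norm (f m) \<le> K * ip_norm ip m)}"

definition dual_norm :: "('m \<Rightarrow> 'm \<Rightarrow> 'a::cstar_algebra) \<Rightarrow> ('m \<Rightarrow> 'a) \<Rightarrow> real" where
  "dual_norm ip f = (SUP m\<in>{m. ip_norm ip m \<le> 1}. norm (f m))"

definition dual_act :: "('m \<Rightarrow> 'a::cstar_algebra) \<Rightarrow> 'a \<Rightarrow> 'm \<Rightarrow> 'a" where
  "dual_act f a = (\<lambda>m. f m * a)"

definition module_embed :: "('m \<Rightarrow> 'm \<Rightarrow> 'a::cstar_algebra) \<Rightarrow> 'm \<Rightarrow> 'm \<Rightarrow> 'a" where
  "module_embed ip m = (\<lambda>n. ip n m)"

definition maps_into_module ::
  "('m \<Rightarrow> 'm \<Rightarrow> 'a::cstar_algebra) \<Rightarrow> ('m \<Rightarrow> 'a) \<Rightarrow> 'a set \<Rightarrow> bool" where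
  "maps_into_module ip f J \<longleftrightarrow> (\<forall>x\<in>J. dual_act f x \<in> range (module_embed ip))"

definition M1 ::
  "('m::complex_vector \<Rightarrow> 'a::cstar_algebra \<Rightarrow> 'm) \<Rightarrow> ('m \<Rightarrow> 'm \<Rightarrow> 'a) \<Rightarrow> ('m \<Rightarrow> 'a) set" where
  "M1 act ip = {f \<in> dual_module act ip.
     \<exists>J. essential_closed_right_ideal J \<and> maps_into_module ip f J}"

text \<open>
  \<open>inv (module_embed ip) (dual_act g x)\<close> is the element of \<open>M\<close> identified with the functional \<open>gx\<close>.
\<close>

definition pairing ::
  "('m \<Rightarrow> 'm \<Rightarrow> 'a::cstar_algebra) \<Rightarrow> ('m \<Rightarrow> 'a) \<Rightarrow> ('m \<Rightarrow> 'a) \<Rightarrow> 'a \<Rightarrow> 'a \<Rightarrow> 'a" where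
  "pairing ip f g x y = dual_act f y (inv (module_embed ip) (dual_act g x))"

definition iota :: "'a::cstar_algebra \<Rightarrow> 'a \<Rightarrow> 'a \<Rightarrow> 'a" where
  "iota a x y = x\<^sup>\<star> * a * y"

text \<open>
  \<open>represents ip f g a\<close> says that \<open>pairing ip f g\<close> and \<open>iota a\<close> agree on \<open>J \<times> A\<close> for some
  admissible \<open>J\<close>; the choice of \<open>J\<close> is immaterial.
\<close>

definition represents ::
  "('m \<Rightarrow> 'm \<Rightarrow> 'a::cstar_algebra) \<Rightarrow> ('m \<Rightarrow> 'a) \<Rightarrow> ('m \<Rightarrow> 'a) \<Rightarrow> 'a \<Rightarrow> bool" where
  "represents ip f g a \<longleftrightarrow>
     (\<exists>J. essential_closed_right_ideal J \<and> maps_into_module ip f J \<and> maps_into_module ip g J \<and>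
          (\<forall>x\<in>J. \<forall>y. pairing ip f g x y = iota a x y))"

definition M0 ::
  "('m::complex_vector \<Rightarrow> 'a::cstar_algebra \<Rightarrow> 'm) \<Rightarrow> ('m \<Rightarrow> 'm \<Rightarrow> 'a) \<Rightarrow> ('m \<Rightarrow> 'a) set" where
  "M0 act ip = {f \<in> M1 act ip. \<forall>g \<in> M1 act ip. \<exists>a. represents ip f g a}"

text \<open>The order of the arguments is swapped: \<open>\<langle>g, f\<rangle>\<close> represents \<open>pairing ip f g\<close>.\<close>

definition ip0 :: "('m \<Rightarrow> 'm \<Rightarrow> 'a::cstar_algebra) \<Rightarrow> ('m \<Rightarrow> 'a) \<Rightarrow> ('m \<Rightarrow> 'a) \<Rightarrow> 'a" where
  "ip0 ip g f = (THE a. represents ip f g a)"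

definition M_tilde ::
  "('m::complex_vector \<Rightarrow> 'a::cstar_algebra \<Rightarrow> 'm) \<Rightarrow> ('m \<Rightarrow> 'm \<Rightarrow> 'a) \<Rightarrow> ('m \<Rightarrow> 'a) set" where
  "M_tilde act ip =
     {f \<in> dual_module act ip. \<forall>e>0. \<exists>g \<in> M0 act ip. dual_norm ip (f - g) < e}"

definition ip_tilde ::
  "('m::complex_vector \<Rightarrow> 'a::cstar_algebra \<Rightarrow> 'm) \<Rightarrow> ('m \<Rightarrow> 'm \<Rightarrow> 'a) \<Rightarrow>
     ('m \<Rightarrow> 'a) \<Rightarrow> ('m \<Rightarrow> 'a) \<Rightarrow> 'a" where
  "ip_tilde act ip g f =
     (THE a. \<forall>G F. (\<forall>n. G n \<in> M0 act ip) \<and> (\<forall>n. F n \<in> M0 act ip) \<and>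
        (\<lambda>n. dual_norm ip (G n - g)) \<longlonglongrightarrow> 0 \<and> (\<lambda>n. dual_norm ip (F n - f)) \<longlonglongrightarrow> 0
        \<longrightarrow> (\<lambda>n. ip0 ip (G n) (F n)) \<longlonglongrightarrow> a)"

end

theory Submission
  imports Defs "HOL-Analysis.Bounded_Linear_Function"
begin

text \<open>
  Let \<open>f\<close> and \<open>g\<close> lie in \<open>M\<^sub>1\<close>.  That \<open>\<langle>g, f\<rangle> = a\<close> means \<open>f m = x\<^sup>\<star> a\<close> whenever \<open>g x\<close> is the functional
  of an element \<open>m\<close> of \<open>M\<close>.  This relation (\<open>pairs\<close> below) mentions no ideal, and it holds for the
  elements \<open>x\<close> of one admissible essential ideal \<open>J\<close> only if it holds for all \<open>x\<close>, because
  \<open>{z. x z \<in> J}\<close> is again essential and an element killed by an essential ideal is zero.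
  From this description the algebraic laws of the inner product on \<open>M\<^sub>0\<close>, the inclusion
  \<open>M \<subseteq> M\<^sub>0\<close> and the formula \<open>\<langle>m, f\<rangle> = f m\<close> are immediate.

  The analytic content is that an essential ideal sees the order and the norm of \<open>A\<close>.  For \<open>x\<close> in \<open>J\<close>
  with \<open>f x = m\<close> one has \<open>x\<^sup>\<star> \<langle>f, f\<rangle> x = \<langle>m, m\<rangle>\<close>, which is positive and of norm at most
  \<open>\<parallel>f\<parallel>\<^sup>2 \<parallel>x\<parallel>\<^sup>2\<close>; one needs \<open>\<langle>f, f\<rangle> \<ge> 0\<close> and \<open>\<parallel>\<langle>f, f\<rangle>\<parallel> \<le> \<parallel>f\<parallel>\<^sup>2\<close>.  Suppose a self-adjoint \<open>T\<close> is not positive.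
  Then \<open>n = \<bar>T\<bar> - T\<close> is non-zero and \<open>T n = - \<bar>T\<bar> n\<close>, and the right ideal \<open>n A\<close> meets \<open>J\<close>; on an
  element of the intersection \<open>T\<close> acts as \<open>- \<bar>T\<bar>\<close>, a contradiction.  With \<open>T = a\<close> this gives positivity
  (\<open>positive_if_positive_on_essential\<close>), and with \<open>T = L - a\<close> and \<open>T = L + a\<close>, for every \<open>L\<close> above the
  required bound, the norm estimate (\<open>norm_le_if_on_essential\<close>).  As \<open>A\<close> may lack a unit, \<open>T\<close> is a multiplier of \<open>A\<close>.

  The order theory behind this is developed without spectra.  In a unital C*-algebra a self-adjoint \<open>x\<close> is
  called non-negative if \<open>\<parallel>r - x\<parallel> \<le> r\<close> for some \<open>r \<ge> 0\<close>; this visibly defines a convex cone.  Square roots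
  come from an iteration that converges for \<open>\<parallel>1 - x\<parallel> \<le> 1\<close>, and since its members are polynomials in
  \<open>x\<close> they yield, with uniqueness of roots, everything else: squares are non-negative, the cone is closed, and
  \<open>b\<^sup>\<star> b\<close> is non-negative for every \<open>b\<close> (\<open>nonneg_star_mult_self\<close>).

  The equality of the norm of \<open>\<langle>\<cdot>, \<cdot>\<rangle>\<close> with the norm of \<open>M'\<close> on \<open>M\<^sub>0\<close> (\<open>ip_norm_ip0\<close>), together with the
  Cauchy-Schwarz inequality, makes the extension to the closure a routine limit.
  For uniqueness, an inner product extending that of \<open>M\<close> satisfies \<open>\<langle>m, f\<rangle> x = \<langle>m, f x\<rangle> = f m x\<close> for \<open>x\<close> in
  an essential ideal, so it equals \<open>f m\<close> on pairs \<open>(m, f)\<close>; hence it obeys the relation that defines \<open>\<langle>g, f\<rangle>\<close> on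
  \<open>M\<^sub>0\<close>, and continuity does the rest.
\<close>

section \<open>Elementary facts on C*-algebras\<close>

lemma half_plus_half: "(1/2) *\<^sub>R x + (1/2) *\<^sub>R x = (x::'a::real_vector)"
  by (subst scaleR_left_distrib[symmetric]) simp

lemma half_plus_half': "(1/2) *\<^sub>R x + ((1/2) *\<^sub>R x + y) = x + (y::'a::real_vector)"
  by (simp only: add.assoc[symmetric] half_plus_half)

lemma star_zero [simp]: "(0::'a::cstar_algebra)\<^sup>\<star> = 0"
  using star_add[of "0::'a" 0] by simp

lemma star_minus: "(- x)\<^sup>\<star> = - (x::'a::cstar_algebra)\<^sup>\<star>"
  using star_add[of x "- x"] by (simp add: eq_neg_iff_add_eq_0 add.commute)

lemma star_diff: "(x - y)\<^sup>\<star> = x\<^sup>\<star> - (y::'a::cstar_algebra)\<^sup>\<star>"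
  using star_add[of x "- y"] by (simp add: star_minus)

lemma star_scaleR: "(r *\<^sub>R x)\<^sup>\<star> = r *\<^sub>R (x::'a::cstar_algebra)\<^sup>\<star>"
  by (simp add: scaleR_scaleC star_scaleC)

lemma norm_star [simp]: "norm (x\<^sup>\<star>) = norm (x::'a::cstar_algebra)"
proof -
  have le: "norm y \<le> norm (y\<^sup>\<star>)" for y :: 'a
  proof (cases "y = 0")
    case False
    have "norm y * norm y \<le> norm (y\<^sup>\<star>) * norm y"
      using cstar_identity[of y] norm_mult_ineq[of "y\<^sup>\<star>" y] by (simp add: power2_eq_square)
    with False show ?thesis by simp
  qed simp
  from le[of x] le[of "x\<^sup>\<star>"] show ?thesis by (simp add: star_star)
qed

lemma bounded_linear_star: "bounded_linear (star :: 'a::cstar_algebra \<Rightarrow> 'a)"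
  by (rule bounded_linear_intro[where K = 1]) (simp_all add: star_add star_scaleR)

lemmas tendsto_star = bounded_linear.tendsto[OF bounded_linear_star]

lemma star_mult_self_eq_0 [simp]: "x\<^sup>\<star> * x = 0 \<longleftrightarrow> (x::'a::cstar_algebra) = 0"
  using cstar_identity[of x] by (metis mult_zero_right norm_eq_zero power_eq_0_iff)

lemma mult_self_eq_0: "(x::'a::cstar_algebra)\<^sup>\<star> = x \<Longrightarrow> x * x = 0 \<Longrightarrow> x = 0"
  using star_mult_self_eq_0[of x] by simp

lemma scaleC_zero_right [simp]: "c *\<^sub>C (0::'v::complex_vector) = 0"
  using scaleC_add_right[of c 0 0] by simp

lemma scaleC_zero_left [simp]: "0 *\<^sub>C (x::'v::complex_vector) = 0"
  using scaleC_add_left[of 0 0 x] by simp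

lemma scaleC_minus_right: "c *\<^sub>C (- x) = - (c *\<^sub>C (x::'v::complex_vector))"
  using scaleC_add_right[of c x "- x"] by (simp add: eq_neg_iff_add_eq_0 add.commute)

lemma scaleC_minus_left: "(- c) *\<^sub>C x = - (c *\<^sub>C (x::'v::complex_vector))"
  using scaleC_add_left[of c "- c" x] by (simp add: eq_neg_iff_add_eq_0 add.commute)

lemma scaleC_diff_right: "c *\<^sub>C (x - y) = c *\<^sub>C x - c *\<^sub>C (y::'v::complex_vector)"
  using scaleC_add_right[of c x "- y"] by (simp add: scaleC_minus_right)

lemmas scaleC_simps = scaleC_add_right scaleC_diff_right scaleC_minus_right scaleC_minus_left
  scaleC_scaleC scaleC_one mult_scaleC_left mult_scaleC_right

lemma commute_mult:
  fixes a b c :: "'a::semigroup_mult"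
  assumes "a * c = c * a" "b * c = c * b"
  shows "(a * b) * c = c * (a * b)"
proof -
  have "(a * b) * c = a * (c * b)" by (simp only: mult.assoc assms(2))
  also have "\<dots> = c * (a * b)" by (simp only: mult.assoc[symmetric] assms(1))
  finally show ?thesis .
qed

lemma square_mult_commute:
  fixes a b :: "'a::semigroup_mult"
  assumes "a * b = b * a"
  shows "(a * b) * (a * b) = (a * a) * (b * b)"
proof -
  have "(a * b) * (a * b) = a * ((b * a) * b)" by (simp only: mult.assoc)
  also have "\<dots> = (a * a) * (b * b)" by (simp only: mult.assoc assms[symmetric])
  finally show ?thesis .
qed

text \<open>
  The element \<open>z = p + i q\<close> satisfies \<open>z\<^sup>\<star> z = p\<^sup>2 + q\<^sup>2\<close>, and \<open>p\<close> is its real part, so \<open>\<parallel>p\<parallel> \<le> \<parallel>z\<parallel>\<close>.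
  Monotonicity of the norm on sums of commuting squares is thus available before any order theory.
\<close>

lemma norm_square_le_sum_squares:
  fixes p q :: "'a::cstar_algebra"
  assumes p: "p\<^sup>\<star> = p" and q: "q\<^sup>\<star> = q" and pq: "p * q = q * p"
  shows "norm (p * p) \<le> norm (p * p + q * q)"
proof -
  define z where "z = p + \<i> *\<^sub>C q"
  have zs: "z\<^sup>\<star> = p + (- \<i>) *\<^sub>C q"
    by (simp add: z_def star_add star_scaleC p q)
  have zz: "z\<^sup>\<star> * z = p * p + q * q"
    unfolding zs unfolding z_def
    by (simp add: algebra_simps scaleC_simps pq)
  have "2 *\<^sub>R p = z + z\<^sup>\<star>"
    unfolding zs unfolding z_def by (simp add: scaleC_simps scaleR_2)
  then have "2 * norm p = norm (z + z\<^sup>\<star>)"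
    by (metis abs_numeral norm_scaleR)
  also have "\<dots> \<le> 2 * norm z"
    using norm_triangle_ineq[of z "z\<^sup>\<star>"] by simp
  finally have "(norm p)\<^sup>2 \<le> (norm z)\<^sup>2"
    by (simp add: power_mono)
  then show ?thesis
    using cstar_identity[of p] cstar_identity[of z] by (simp add: p zz)
qed

section \<open>Positive elements of a unital C*-algebra\<close>

text \<open>
  The class \<open>ring_1\<close> would demand \<open>0 \<noteq> 1\<close>, which fails for the multipliers of the zero algebra.
\<close>

class unital_cstar_algebra = cstar_algebra + monoid_mult

lemma star_one [simp]: "(1::'a::unital_cstar_algebra)\<^sup>\<star> = 1"
  by (metis mult_1_left mult_1_right star_mult star_star)

lemma norm_one_le: "norm (1::'a::unital_cstar_algebra) \<le> 1"
proof -
  have "norm (1::'a) * norm (1::'a) = norm (1::'a) * 1"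
    using cstar_identity[of "1::'a"] by (simp add: power2_eq_square)
  then show ?thesis by (metis mult_cancel_left norm_zero zero_le_one order_refl)
qed

text \<open>
  In terms of the spectrum the norm condition says that the spectrum of \<open>x\<close> lies in \<open>[0, 2 r]\<close>.
\<close>

definition nonneg :: "'a::unital_cstar_algebra \<Rightarrow> bool" where
  "nonneg x \<longleftrightarrow> x\<^sup>\<star> = x \<and> (\<exists>r\<ge>0. norm (r *\<^sub>R 1 - x) \<le> r)"

lemma nonneg_star: "nonneg x \<Longrightarrow> x\<^sup>\<star> = x"
  by (simp add: nonneg_def)

lemma radius_mono:
  fixes x :: "'a::unital_cstar_algebra"
  assumes "norm (r *\<^sub>R 1 - x) \<le> r" "r \<le> s"
  shows "norm (s *\<^sub>R 1 - x) \<le> s"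
proof -
  have "s *\<^sub>R 1 - x = (s - r) *\<^sub>R 1 + (r *\<^sub>R 1 - x)" by (simp add: algebra_simps)
  then have "norm (s *\<^sub>R 1 - x) \<le> norm ((s - r) *\<^sub>R (1::'a)) + norm (r *\<^sub>R 1 - x)"
    by (metis norm_triangle_ineq)
  also have "norm ((s - r) *\<^sub>R (1::'a)) \<le> s - r"
    using assms(2) mult_left_mono[OF norm_one_le[where 'a='a], of "s - r"] by simp
  finally show ?thesis using assms(1) by simp
qed

lemma nonneg_add:
  assumes "nonneg x" "nonneg y" shows "nonneg (x + y)"
proof -
  from assms obtain r s where r: "r \<ge> 0" "norm (r *\<^sub>R 1 - x) \<le> r" and s: "s \<ge> 0" "norm (s *\<^sub>R 1 - y) \<le> s"
    by (auto simp: nonneg_def)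
  have "norm ((r *\<^sub>R 1 - x) + (s *\<^sub>R 1 - y)) \<le> r + s"
    by (rule order_trans[OF norm_triangle_ineq add_mono[OF r(2) s(2)]])
  also have "(r *\<^sub>R 1 - x) + (s *\<^sub>R 1 - y) = (r + s) *\<^sub>R 1 - (x + y)" by (simp add: algebra_simps)
  finally have "norm ((r + s) *\<^sub>R 1 - (x + y)) \<le> r + s" .
  then show ?thesis using assms r s unfolding nonneg_def
    by (metis add_nonneg_nonneg star_add)
qed

lemma nonneg_scaleR:
  assumes "nonneg x" "c \<ge> 0" shows "nonneg (c *\<^sub>R x)"
proof -
  from assms obtain r where r: "r \<ge> 0" "norm (r *\<^sub>R 1 - x) \<le> r" by (auto simp: nonneg_def)
  have "(c * r) *\<^sub>R 1 - c *\<^sub>R x = c *\<^sub>R (r *\<^sub>R 1 - x)" by (simp add: algebra_simps)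
  then have "norm ((c * r) *\<^sub>R 1 - c *\<^sub>R x) \<le> c * r"
    using r assms by (simp add: mult_left_mono)
  then show ?thesis using assms r unfolding nonneg_def
    by (metis mult_nonneg_nonneg star_scaleR)
qed

subsection \<open>Square roots by iteration\<close>

text \<open>
  The substitution \<open>p = 1 - w\<close>, \<open>x = 1 - y\<close> turns the step into \<open>w \<mapsto> (y + w\<^sup>2) / 2\<close>, which started at \<open>0\<close>
  produces polynomials in \<open>y\<close> with non-negative coefficients.  For \<open>\<parallel>y\<parallel> \<le> 1\<close> the elements \<open>w\<close> and their
  increments are therefore dominated by the real sequence that belongs to \<open>y = 1\<close>; this is \<open>sqrt_bound\<close>.
\<close>

primrec sqrt_iter :: "'a::unital_cstar_algebra \<Rightarrow> nat \<Rightarrow> 'a" where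
  "sqrt_iter x 0 = 1"
| "sqrt_iter x (Suc n) = sqrt_iter x n + (1/2) *\<^sub>R (x - sqrt_iter x n * sqrt_iter x n)"

primrec sqrt_bound :: "nat \<Rightarrow> real" where
  "sqrt_bound 0 = 0"
| "sqrt_bound (Suc n) = (1 + (sqrt_bound n)\<^sup>2) / 2"

lemma sqrt_bound_range: "0 \<le> sqrt_bound n \<and> sqrt_bound n \<le> 1"
proof (induction n)
  case (Suc n)
  then have "(sqrt_bound n)\<^sup>2 \<le> 1" by (simp add: power_le_one)
  then show ?case using Suc by simp
qed simp

lemma sqrt_bound_incseq: "incseq sqrt_bound"
proof (rule incseq_SucI)
  fix n
  have "0 \<le> (1 - sqrt_bound n)\<^sup>2" by simp
  then show "sqrt_bound n \<le> sqrt_bound (Suc n)" by (simp add: power2_eq_square algebra_simps)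
qed

lemma sqrt_bound_tendsto: "sqrt_bound \<longlonglongrightarrow> 1"
proof -
  obtain L where L: "sqrt_bound \<longlonglongrightarrow> L"
    using incseq_convergent[OF sqrt_bound_incseq, of 1] sqrt_bound_range by blast
  have "(\<lambda>n. sqrt_bound (Suc n)) \<longlonglongrightarrow> (1 + L\<^sup>2) / 2"
    unfolding sqrt_bound.simps by (intro tendsto_intros L) simp
  then have "L = (1 + L\<^sup>2) / 2"
    using LIMSEQ_unique LIMSEQ_Suc[OF L] by blast
  then have "(1 - L)\<^sup>2 = 0" by (simp add: power2_eq_square algebra_simps)
  then show ?thesis using L by simp
qed

text \<open>
  The iterates are polynomials in \<open>x\<close>, so every element that intertwines \<open>x\<close> and \<open>y\<close> intertwines their iterates.
  In the limit this passes to the square roots and replaces the use of a functional calculus.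
\<close>

lemma sqrt_iter_intertwine:
  assumes "c * x = y * c"
  shows "c * sqrt_iter x n = sqrt_iter y n * c"
proof (induction n)
  case (Suc n)
  have "c * (sqrt_iter x n * sqrt_iter x n) = (sqrt_iter y n * sqrt_iter y n) * c"
    by (metis Suc mult.assoc)
  then show ?case using Suc assms by (simp add: algebra_simps)
qed simp

lemma sqrt_iter_star:
  assumes "x\<^sup>\<star> = x" shows "(sqrt_iter x n)\<^sup>\<star> = sqrt_iter x n"
  by (induction n) (simp_all add: assms star_add star_diff star_scaleR star_mult)

lemma norm_one_minus_sqrt_iter:
  assumes "norm (1 - x) \<le> 1"
  shows "norm (1 - sqrt_iter x n) \<le> sqrt_bound n"
proof (induction n)
  case (Suc n)
  let ?p = "sqrt_iter x n"
  have "1 - sqrt_iter x (Suc n) = (1/2) *\<^sub>R (1 - x) + (1/2) *\<^sub>R ((1 - ?p) * (1 - ?p))"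
    by (simp add: algebra_simps half_plus_half half_plus_half')
  then have "norm (1 - sqrt_iter x (Suc n)) \<le> (1/2) * norm (1 - x) + (1/2) * norm ((1 - ?p) * (1 - ?p))"
    using norm_triangle_ineq[of "(1/2) *\<^sub>R (1 - x)" "(1/2) *\<^sub>R ((1 - ?p) * (1 - ?p))"] by simp
  also have "norm ((1 - ?p) * (1 - ?p)) \<le> (sqrt_bound n)\<^sup>2"
    unfolding power2_eq_square
    by (rule order_trans[OF norm_mult_ineq mult_mono']) (use Suc in auto)
  finally show ?case using assms by simp
qed simp

lemma norm_sqrt_iter_step:
  assumes "norm (1 - x) \<le> 1"
  shows "norm (sqrt_iter x (Suc n) - sqrt_iter x n) \<le> sqrt_bound (Suc n) - sqrt_bound n"
proof (induction n)
  case 0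
  then show ?case using assms by (simp add: norm_minus_commute)
next
  case (Suc n)
  let ?p = "sqrt_iter x n" and ?q = "sqrt_iter x (Suc n)"
  have "x * ?p = ?p * x" by (rule sqrt_iter_intertwine) simp
  then have comm: "?q * ?p = ?p * ?q" by (simp add: algebra_simps)
  have d: "sqrt_iter x (Suc m) - sqrt_iter x m = (1/2) *\<^sub>R (x - sqrt_iter x m * sqrt_iter x m)" for m
    by simp
  have "sqrt_iter x (Suc (Suc n)) - ?q = (?q - ?p) - (1/2) *\<^sub>R (?q * ?q - ?p * ?p)"
    unfolding d by (simp add: algebra_simps del: sqrt_iter.simps)
  also have "\<dots> = (1/2) *\<^sub>R ((?q - ?p) * ((1 - ?q) + (1 - ?p)))"
    using comm by (simp add: algebra_simps half_plus_half half_plus_half' del: sqrt_iter.simps)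
  finally have "norm (sqrt_iter x (Suc (Suc n)) - ?q) = (1/2) * norm ((?q - ?p) * ((1 - ?q) + (1 - ?p)))"
    by (simp del: sqrt_iter.simps)
  moreover have "norm ((?q - ?p) * ((1 - ?q) + (1 - ?p)))
      \<le> (sqrt_bound (Suc n) - sqrt_bound n) * (sqrt_bound (Suc n) + sqrt_bound n)"
  proof (rule order_trans[OF norm_mult_ineq mult_mono'])
    show "norm ((1 - ?q) + (1 - ?p)) \<le> sqrt_bound (Suc n) + sqrt_bound n"
      by (rule order_trans[OF norm_triangle_ineq add_mono]) (rule norm_one_minus_sqrt_iter[OF assms])+
  qed (use Suc in auto)
  moreover have "(1/2) * ((sqrt_bound (Suc n) - sqrt_bound n) * (sqrt_bound (Suc n) + sqrt_bound n))
      = sqrt_bound (Suc (Suc n)) - sqrt_bound (Suc n)"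
    unfolding sqrt_bound.simps(2)[of "Suc n"] sqrt_bound.simps(2)[of n]
    by (simp add: power2_eq_square field_simps)
  ultimately show ?case by linarith
qed

lemma sqrt_iter_convergent:
  assumes "norm (1 - x) \<le> 1" shows "convergent (sqrt_iter x)"
proof -
  have d: "norm (sqrt_iter x (n + k) - sqrt_iter x n) \<le> sqrt_bound (n + k) - sqrt_bound n" for n k
  proof (induction k)
    case (Suc k)
    show ?case
      using norm_triangle_ineq[of "sqrt_iter x (Suc (n + k)) - sqrt_iter x (n + k)" "sqrt_iter x (n + k) - sqrt_iter x n"]
        norm_sqrt_iter_step[OF assms, of "n + k"] Suc
      by (simp del: sqrt_iter.simps sqrt_bound.simps)
  qed simp
  have "Cauchy (sqrt_iter x)"
  proof (rule CauchyI')
    fix e :: real assume "e > 0"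
    then obtain N where N: "\<forall>m\<ge>N. \<forall>n\<ge>N. norm (sqrt_bound m - sqrt_bound n) < e"
      using CauchyD[OF LIMSEQ_imp_Cauchy[OF sqrt_bound_tendsto]] by blast
    show "\<exists>M. \<forall>m\<ge>M. \<forall>n>m. dist (sqrt_iter x m) (sqrt_iter x n) < e"
    proof (intro exI allI impI)
      fix m n assume "m \<ge> N" "m < n"
      then have "norm (sqrt_bound n - sqrt_bound m) < e" using N by simp
      then show "dist (sqrt_iter x m) (sqrt_iter x n) < e"
        using d[of m "n - m"] \<open>m < n\<close> by (simp add: dist_norm norm_minus_commute)
    qed
  qed
  then show ?thesis by (simp add: Cauchy_convergent)
qed

lemma sqrt_iter_limit:
  assumes x: "x\<^sup>\<star> = x" "norm (1 - x) \<le> 1"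
  obtains s where "sqrt_iter x \<longlonglongrightarrow> s" "nonneg s" "s * s = x"
proof -
  obtain s where s: "sqrt_iter x \<longlonglongrightarrow> s"
    using sqrt_iter_convergent[OF x(2)] by (auto simp: convergent_def)
  have "(\<lambda>n. sqrt_iter x (Suc n)) \<longlonglongrightarrow> s + (1/2) *\<^sub>R (x - s * s)"
    unfolding sqrt_iter.simps by (intro tendsto_intros s)
  then have "s = s + (1/2) *\<^sub>R (x - s * s)"
    using LIMSEQ_unique LIMSEQ_Suc[OF s] by blast
  then have "s * s = x" by simp
  moreover have "s\<^sup>\<star> = s"
    using LIMSEQ_unique[OF tendsto_star[OF s]] s x(1) by (simp add: sqrt_iter_star)
  moreover have "norm (1 - s) \<le> 1"
  proof (rule LIMSEQ_le_const2)
    show "(\<lambda>n. norm (1 - sqrt_iter x n)) \<longlonglongrightarrow> norm (1 - s)" by (intro tendsto_intros s)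
    show "\<exists>N. \<forall>n\<ge>N. norm (1 - sqrt_iter x n) \<le> 1"
      using norm_one_minus_sqrt_iter[OF x(2)] sqrt_bound_range by (meson order_trans)
  qed
  ultimately have "nonneg s" by (auto simp: nonneg_def intro!: exI[of _ 1])
  then show thesis using s \<open>s * s = x\<close> that by blast
qed

lemma radius_rescale:
  fixes x :: "'a::unital_cstar_algebra"
  assumes "norm (r *\<^sub>R 1 - x) \<le> r" "r > 0"
  shows "norm (1 - (1/r) *\<^sub>R x) \<le> 1"
proof -
  have "1 - (1/r) *\<^sub>R x = (1/r) *\<^sub>R (r *\<^sub>R 1 - x)" using assms by (simp add: algebra_simps)
  then have "norm (1 - (1/r) *\<^sub>R x) = (1/r) * norm (r *\<^sub>R 1 - x)" using assms by simp
  then show ?thesis using assms by simp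
qed

text \<open>
  A single radius \<open>r\<close> rescales both \<open>x\<close> and \<open>y\<close>, so that one sequence of polynomials yields both roots and
  the intertwining property survives in the limit.
\<close>

lemma exists_intertwined_sqrts:
  fixes x y :: "'a::unital_cstar_algebra"
  assumes x: "nonneg x" and y: "nonneg y"
  obtains s t where "nonneg s" "s * s = x" "nonneg t" "t * t = y"
    "\<And>c. c * x = y * c \<Longrightarrow> c * s = t * c" "\<And>c. c * x = x * c \<Longrightarrow> c * s = s * c"
proof -
  from x y obtain r1 r2 where r: "norm (r1 *\<^sub>R 1 - x) \<le> r1" "norm (r2 *\<^sub>R 1 - y) \<le> r2"
    by (auto simp: nonneg_def)
  define r where "r = max 1 (max r1 r2)"
  have rp: "r > 0" by (simp add: r_def)
  have nr: "norm (1 - (1/r) *\<^sub>R x) \<le> 1" "norm (1 - (1/r) *\<^sub>R y) \<le> 1"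
    using rp by (auto intro!: radius_rescale radius_mono[OF r(1)] radius_mono[OF r(2)] simp: r_def)
  from sqrt_iter_limit[OF _ nr(1)] x obtain s where s: "sqrt_iter ((1/r) *\<^sub>R x) \<longlonglongrightarrow> s"
      "nonneg s" "s * s = (1/r) *\<^sub>R x"
    by (metis nonneg_star star_scaleR)
  from sqrt_iter_limit[OF _ nr(2)] y obtain t where t: "sqrt_iter ((1/r) *\<^sub>R y) \<longlonglongrightarrow> t"
      "nonneg t" "t * t = (1/r) *\<^sub>R y"
    by (metis nonneg_star star_scaleR)
  have st: "c * s = t * c" if "c * x = y * c" for c
  proof (rule LIMSEQ_unique)
    show "(\<lambda>n. c * sqrt_iter ((1/r) *\<^sub>R x) n) \<longlonglongrightarrow> c * s" by (intro tendsto_intros s)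
    have "c * sqrt_iter ((1/r) *\<^sub>R x) n = sqrt_iter ((1/r) *\<^sub>R y) n * c" for n
      by (rule sqrt_iter_intertwine) (simp add: that)
    then show "(\<lambda>n. c * sqrt_iter ((1/r) *\<^sub>R x) n) \<longlonglongrightarrow> t * c" by (auto intro!: tendsto_intros t)
  qed
  have ss: "c * s = s * c" if "c * x = x * c" for c
  proof (rule LIMSEQ_unique)
    show "(\<lambda>n. c * sqrt_iter ((1/r) *\<^sub>R x) n) \<longlonglongrightarrow> c * s" by (intro tendsto_intros s)
    have "c * sqrt_iter ((1/r) *\<^sub>R x) n = sqrt_iter ((1/r) *\<^sub>R x) n * c" for n
      by (rule sqrt_iter_intertwine) (simp add: that)
    then show "(\<lambda>n. c * sqrt_iter ((1/r) *\<^sub>R x) n) \<longlonglongrightarrow> s * c" by (auto intro!: tendsto_intros s)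
  qed
  have sq: "sqrt r * sqrt r = r" using rp by simp
  show thesis
  proof (rule that[of "sqrt r *\<^sub>R s" "sqrt r *\<^sub>R t"])
    show "nonneg (sqrt r *\<^sub>R s)" "nonneg (sqrt r *\<^sub>R t)"
      using s t rp by (simp_all add: nonneg_scaleR)
    show "sqrt r *\<^sub>R s * sqrt r *\<^sub>R s = x" "sqrt r *\<^sub>R t * sqrt r *\<^sub>R t = y"
      using s(3) t(3) rp sq by simp_all
  qed (simp_all add: st ss)
qed

lemma nonneg_sqrt:
  assumes "nonneg x"
  shows "\<exists>s. nonneg s \<and> s * s = x \<and> (\<forall>c. c * x = x * c \<longrightarrow> c * s = s * c)"
  by (rule exists_intertwined_sqrts[OF assms assms]) blast

subsection \<open>The order\<close>

text \<open>
  Since \<open>1 - h\<close> and \<open>1 + h\<close> have commuting self-adjoint roots \<open>u\<close> and \<open>v\<close>, the element \<open>1 - h\<^sup>2\<close> is the square of \<open>u v\<close>,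
  and \<open>(u v)\<^sup>2 + h\<^sup>2 = 1\<close> bounds it.
\<close>

lemma norm_one_minus_square_le:
  fixes h :: "'a::unital_cstar_algebra"
  assumes h: "h\<^sup>\<star> = h" "norm h \<le> 1"
  shows "norm (1 - h * h) \<le> 1"
proof -
  have pos: "nonneg (1 - h)" "nonneg (1 + h)"
    using h by (auto simp: nonneg_def star_add star_diff intro!: exI[of _ 1])
  obtain u where u: "nonneg u" "u * u = 1 - h" "\<And>c. c * (1 - h) = (1 - h) * c \<Longrightarrow> c * u = u * c"
    using nonneg_sqrt[OF pos(1)] by blast
  obtain v where v: "nonneg v" "v * v = 1 + h" "\<And>c. c * (1 + h) = (1 + h) * c \<Longrightarrow> c * v = v * c"
    using nonneg_sqrt[OF pos(2)] by blast
  have hu: "h * u = u * h" by (rule u(3)) (simp add: algebra_simps)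
  have hv: "h * v = v * h" by (rule v(3)) (simp add: algebra_simps)
  have uv: "u * v = v * u" by (rule v(3)) (simp add: algebra_simps hu)
  define k where "k = u * v"
  have k: "k\<^sup>\<star> = k" using u(1) v(1) by (simp add: k_def star_mult nonneg_star uv)
  have "k * k = (u * u) * (v * v)" unfolding k_def by (rule square_mult_commute[OF uv])
  then have kk: "k * k = 1 - h * h" unfolding u(2) v(2) by (simp add: algebra_simps)
  have "k * h = h * k" unfolding k_def by (rule commute_mult) (simp_all add: hu hv)
  from norm_square_le_sum_squares[OF k h(1) this] show ?thesis
    using norm_one_le[where 'a='a] by (simp add: kk)
qed

lemma nonneg_square:
  assumes h: "h\<^sup>\<star> = h" shows "nonneg (h * h)"
proof -
  define r where "r = norm h + 1"
  have r: "r > 0" by (simp add: r_def add_nonneg_pos)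
  have "norm (1 - ((1/r) *\<^sub>R h) * ((1/r) *\<^sub>R h)) \<le> 1"
    by (rule norm_one_minus_square_le) (use h r in \<open>auto simp: star_scaleR r_def field_simps\<close>)
  then have "nonneg (((1/r) *\<^sub>R h) * ((1/r) *\<^sub>R h))"
    using h by (auto simp: nonneg_def star_scaleR star_mult intro!: exI[of _ 1])
  from nonneg_scaleR[OF this, of "r * r"] show ?thesis using r by simp
qed

lemma nonneg_mult_commuting:
  assumes x: "nonneg x" and y: "nonneg y" and xy: "x * y = y * x"
  shows "nonneg (x * y)"
proof -
  obtain s where s: "nonneg s" "s * s = x" "\<And>c. c * x = x * c \<Longrightarrow> c * s = s * c"
    using nonneg_sqrt[OF x] by blast
  obtain t where t: "nonneg t" "t * t = y" "\<And>c. c * y = y * c \<Longrightarrow> c * t = t * c"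
    using nonneg_sqrt[OF y] by blast
  have "y * s = s * y" by (rule s(3)) (simp add: xy)
  then have st: "s * t = t * s" using t(3) by metis
  have "nonneg ((s * t) * (s * t))"
    by (rule nonneg_square) (use s(1) t(1) st in \<open>simp add: star_mult nonneg_star\<close>)
  also have "(s * t) * (s * t) = x * y"
    using square_mult_commute[OF st] by (simp only: s(2) t(2))
  finally show ?thesis .
qed

text \<open>
  Any bound of the norm of \<open>x\<close> serves as the radius, which makes the cone closed: along a convergent sequence
  one radius works for all members.
\<close>

lemma nonneg_radius_norm:
  assumes x: "nonneg x" and r: "norm x \<le> r"
  shows "norm (r *\<^sub>R 1 - x) \<le> r"
proof (cases "r = 0")
  case False
  with order_trans[OF norm_ge_zero r] have r0: "r > 0" by simp
  obtain s where s: "nonneg s" "s * s = x" using nonneg_sqrt[OF x] by metis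
  define h where "h = (1 / sqrt r) *\<^sub>R s"
  have hs: "h\<^sup>\<star> = h" using s by (simp add: h_def star_scaleR nonneg_star)
  have hh: "h * h = (1/r) *\<^sub>R x" using s r0 by (simp add: h_def)
  have "(norm h)\<^sup>2 = norm x / r"
    using cstar_identity[of h] r0 by (simp add: hs hh)
  also have "\<dots> \<le> 1" using r r0 by simp
  finally have "(norm h)\<^sup>2 \<le> 1" .
  then have "norm h \<le> 1" by (simp add: power2_le_imp_le abs_square_le_1)
  from norm_one_minus_square_le[OF hs this] have "r * norm (1 - (1/r) *\<^sub>R x) \<le> r"
    using hh r0 by simp
  also have "r * norm (1 - (1/r) *\<^sub>R x) = norm (r *\<^sub>R (1 - (1/r) *\<^sub>R x))" using r0 by simp
  also have "r *\<^sub>R (1 - (1/r) *\<^sub>R x) = r *\<^sub>R 1 - x" using r0 by (simp add: algebra_simps)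
  finally show ?thesis .
qed (use r in simp)

lemma nonneg_LIMSEQ:
  assumes X: "\<And>n. nonneg (X n)" and lim: "X \<longlonglongrightarrow> x"
  shows "nonneg x"
proof -
  obtain R where R: "\<And>n. norm (X n) \<le> R" "R > 0"
    using convergent_imp_Bseq[of X] lim unfolding Bseq_def convergent_def by blast
  have "norm (R *\<^sub>R 1 - x) \<le> R"
    by (rule LIMSEQ_le_const2[of "\<lambda>n. norm (R *\<^sub>R 1 - X n)"])
      (use X R lim in \<open>auto intro!: tendsto_intros nonneg_radius_norm\<close>)
  moreover have "x\<^sup>\<star> = x"
    using LIMSEQ_unique[OF tendsto_star[OF lim]] lim X by (simp add: nonneg_star)
  ultimately show ?thesis using R(2) by (auto simp: nonneg_def intro: less_imp_le)
qed

lemma sum_squares_eq_0: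
  assumes p: "p\<^sup>\<star> = p" and q: "q\<^sup>\<star> = (q::'a::cstar_algebra)" and pq: "p * q = q * p" and z: "p * p + q * q = 0"
  shows "p = 0"
  using norm_square_le_sum_squares[OF p q pq] z p by (simp add: mult_self_eq_0)

lemma nonneg_sqrt_unique:
  assumes s: "nonneg s" and t: "nonneg t" and eq: "s * s = t * t"
  shows "s = t"
proof -
  obtain t' where t': "nonneg t'" "t' * t' = s * s" "\<And>c. c * (s * s) = (s * s) * c \<Longrightarrow> c * t' = t' * c"
    using nonneg_sqrt[OF nonneg_square[OF nonneg_star[OF s]]] by blast
  \<comment> \<open>The root \<open>t'\<close> commutes with everything that commutes with its square, hence with any other root \<open>u\<close>;
    for \<open>d = u - t'\<close>, with \<open>v\<close> and \<open>w\<close> roots of \<open>u\<close> and \<open>t'\<close>, the squares of \<open>v d\<close> and \<open>w d\<close> add up to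
    \<open>(u + t') d\<^sup>2 = (u\<^sup>2 - t'\<^sup>2) d = 0\<close>.\<close>
  have main: "u = t'" if u: "nonneg u" "u * u = s * s" for u
  proof -
    have ut: "u * t' = t' * u" by (rule t'(3)) (simp only: u(2)[symmetric] mult.assoc)
    define d where "d = u - t'"
    have d: "d\<^sup>\<star> = d" using u(1) t'(1) by (simp add: d_def star_diff nonneg_star)
    obtain v where v: "nonneg v" "v * v = u" "\<And>c. c * u = u * c \<Longrightarrow> c * v = v * c"
      using nonneg_sqrt[OF u(1)] by blast
    obtain w where w: "nonneg w" "w * w = t'" "\<And>c. c * t' = t' * c \<Longrightarrow> c * w = w * c"
      using nonneg_sqrt[OF t'(1)] by blast
    have dv: "d * v = v * d" by (rule v(3)) (simp add: d_def algebra_simps ut)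
    have dw: "d * w = w * d" by (rule w(3)) (simp add: d_def algebra_simps ut)
    have "t' * v = v * t'" by (rule v(3)) (simp add: ut)
    then have vw: "v * w = w * v" using w(3) by metis
    have e1: "(v * d) * (v * d) = u * (d * d)" using square_mult_commute[OF dv[symmetric]] by (simp only: v(2))
    have e2: "(w * d) * (w * d) = t' * (d * d)" using square_mult_commute[OF dw[symmetric]] by (simp only: w(2))
    have "(u + t') * d = u * u - t' * t'" by (simp add: d_def algebra_simps ut)
    then have "(u + t') * d = 0" by (simp add: u(2) t'(2))
    then have "(u + t') * (d * d) = 0" by (simp only: mult.assoc[symmetric] mult_zero_left)
    then have "(v * d) * (v * d) + (w * d) * (w * d) = 0"
      unfolding e1 e2 by (simp only: distrib_right)
    moreover have "(v * d)\<^sup>\<star> = v * d" "(w * d)\<^sup>\<star> = w * d"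
      using v(1) w(1) d by (simp_all add: star_mult nonneg_star dv dw)
    moreover have "(v * d) * (w * d) = (w * d) * (v * d)" by (intro commute_mult commute_mult[symmetric]) (simp_all only: dv dw vw)
    ultimately have "v * d = 0" "w * d = 0"
      using sum_squares_eq_0[of "v * d" "w * d"] sum_squares_eq_0[of "w * d" "v * d"]
      by (simp_all add: add.commute)
    then have "u * d = 0" "t' * d = 0"
      by (simp_all only: v(2)[symmetric] w(2)[symmetric] mult.assoc mult_zero_right)
    then have "d * d = 0" by (simp add: d_def algebra_simps)
    then show ?thesis using mult_self_eq_0[OF d] by (simp add: d_def)
  qed
  from main[OF s] main[OF t] eq show ?thesis by simp
qed

text \<open>
  By uniqueness the roots \<open>s\<close> and \<open>t\<close> are those constructed by the iteration.
\<close>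

lemma nonneg_sqrt_intertwine:
  assumes s: "nonneg s" and t: "nonneg t" and c: "c * (s * s) = (t * t) * c"
  shows "c * s = t * c"
proof -
  from exists_intertwined_sqrts[OF nonneg_square nonneg_square, of s t] s t
  obtain s' t' where "nonneg s'" "s' * s' = s * s" "nonneg t'" "t' * t' = t * t"
    "c * s' = t' * c" using c by (metis nonneg_star)
  with nonneg_sqrt_unique s t show ?thesis by metis
qed

lemma nonneg_antisym:
  assumes "nonneg x" "nonneg (- x)" shows "x = 0"
proof -
  have "x = - x" by (rule nonneg_sqrt_unique[OF assms]) simp
  then have "2 *\<^sub>R x = 0" by (metis add.right_inverse scaleR_2)
  then show ?thesis by simp
qed

lemma abs_decomposition:
  fixes a :: "'a::unital_cstar_algebra"
  assumes a: "a\<^sup>\<star> = a"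
  obtains m s where "nonneg m" "m * m = a * a" "nonneg s" "s * s = m" "a * m = m * a" "a * s = s * a"
proof -
  from nonneg_sqrt[OF nonneg_square[OF a]] obtain m where m: "nonneg m" "m * m = a * a" "a * m = m * a"
    by (metis mult.assoc)
  from nonneg_sqrt[OF m(1)] obtain s where "nonneg s" "s * s = m" "a * s = s * a" using m by metis
  with m that show thesis by blast
qed

text \<open>
  With \<open>m = \<bar>a\<bar> = s\<^sup>2\<close>, the element \<open>n = m - a\<close> is twice the negative part of \<open>a\<close>: it satisfies \<open>a n = - m n\<close>
  and \<open>n\<^sup>2 = 2 m n\<close>.  The lemma lets a proof of \<open>a \<ge> 0\<close> work with these identities alone; if \<open>n = 0\<close> then
  \<open>a = m\<close>.
\<close>

lemma nonneg_if_no_negative_part: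
  fixes a :: "'a::unital_cstar_algebra"
  assumes a: "a\<^sup>\<star> = a"
    and neg: "\<And>n s. n\<^sup>\<star> = n \<Longrightarrow> s\<^sup>\<star> = s \<Longrightarrow> s * n = n * s \<Longrightarrow> a * n = - (s * s * n) \<Longrightarrow> n * n = 2 *\<^sub>R (s * s * n) \<Longrightarrow> n = 0"
  shows "nonneg a"
proof -
  obtain m s where ms: "nonneg m" "m * m = a * a" "nonneg s" "s * s = m" "a * m = m * a" "a * s = s * a"
    using abs_decomposition[OF a] by blast
  have sm: "s * m = m * s" by (simp only: ms(4)[symmetric] mult.assoc)
  have "m - a = 0"
  proof (rule neg)
    show "(m - a)\<^sup>\<star> = m - a" "s\<^sup>\<star> = s" using ms a by (simp_all add: star_diff nonneg_star)
    show "s * (m - a) = (m - a) * s" by (simp add: algebra_simps sm ms)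
    show "a * (m - a) = - (s * s * (m - a))" by (simp add: algebra_simps ms)
    show "(m - a) * (m - a) = 2 *\<^sub>R (s * s * (m - a))" by (simp add: algebra_simps ms scaleR_2)
  qed
  then show ?thesis using ms(1) by simp
qed

text \<open>
  Let \<open>n\<close> be twice the negative part of \<open>b\<^sup>\<star> b\<close> and \<open>c = b n\<close>.  Then \<open>c\<^sup>\<star> c = - k\<^sup>2\<close> with \<open>k\<close> self-adjoint, while
  \<open>c c\<^sup>\<star> + c\<^sup>\<star> c\<close> is a sum of squares of self-adjoint elements, so \<open>c c\<^sup>\<star>\<close> is non-negative.  Now \<open>c\<close> intertwines
  the squares of \<open>k\<^sup>2\<close> and \<open>c c\<^sup>\<star>\<close>, hence these elements themselves: \<open>c k\<^sup>2 = c c\<^sup>\<star> c = - c k\<^sup>2\<close>, and everything vanishes.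
\<close>

lemma nonneg_star_mult_self: "nonneg (b\<^sup>\<star> * (b::'a::unital_cstar_algebra))"
proof (rule nonneg_if_no_negative_part)
  show "(b\<^sup>\<star> * b)\<^sup>\<star> = b\<^sup>\<star> * b" by (simp add: star_mult star_star)
  fix n s :: 'a
  assume n: "n\<^sup>\<star> = n" and s: "s\<^sup>\<star> = s" and sn: "s * n = n * s" and an: "b\<^sup>\<star> * b * n = - (s * s * n)"
    and nn: "n * n = 2 *\<^sub>R (s * s * n)"
  define c where "c = b * n"
  define k where "k = s * n"
  have k: "k\<^sup>\<star> = k" by (simp add: k_def star_mult n s sn)
  have cc: "c\<^sup>\<star> * c = - (k * k)"
  proof -
    have "c\<^sup>\<star> * c = n * (b\<^sup>\<star> * b * n)" by (simp add: c_def star_mult n mult.assoc)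
    also have "\<dots> = - (n * (s * s * n))" unfolding an by simp
    also have "n * (s * s * n) = (n * s) * (s * n)" by (simp only: mult.assoc)
    also have "\<dots> = k * k" by (simp only: k_def sn)
    finally show ?thesis .
  qed
  \<comment> \<open>twice the real and the imaginary part of \<open>c\<close>\<close>
  define p where "p = c + c\<^sup>\<star>"
  define q where "q = (- \<i>) *\<^sub>C (c - c\<^sup>\<star>)"
  have p: "p\<^sup>\<star> = p" by (simp add: p_def star_add star_star add.commute)
  have q: "q\<^sup>\<star> = q" by (simp add: q_def star_scaleC star_diff star_star scaleC_simps)
  have "p * p + q * q = 2 *\<^sub>R (c\<^sup>\<star> * c + c * c\<^sup>\<star>)"
    by (simp add: p_def q_def scaleC_simps algebra_simps scaleR_2)
  then have "(1/2) *\<^sub>R (p * p + q * q) = c\<^sup>\<star> * c + c * c\<^sup>\<star>" by simp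
  then have "c * c\<^sup>\<star> = (1/2) *\<^sub>R (p * p + q * q) + k * k" by (simp add: cc)
  then have S: "nonneg (c * c\<^sup>\<star>)"
    using p q k by (simp add: nonneg_add nonneg_scaleR nonneg_square)
  have "c * (k * k) = (c * c\<^sup>\<star>) * c"
  proof (rule nonneg_sqrt_intertwine[OF nonneg_square[OF k] S])
    have "k * k = - (c\<^sup>\<star> * c)" by (simp add: cc)
    then show "c * (k * k * (k * k)) = c * c\<^sup>\<star> * (c * c\<^sup>\<star>) * c" by (simp add: mult.assoc)
  qed
  also have "\<dots> = - (c * (k * k))" by (simp add: mult.assoc cc)
  finally have "c * (k * k) + c * (k * k) = 0" by (metis add.right_inverse)
  then have "2 *\<^sub>R (c * (k * k)) = 0" by (simp only: scaleR_2)
  then have ckk: "c * (k * k) = 0" by simp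
  have "(k * k) * (k * k) = - (c\<^sup>\<star> * c) * (k * k)" by (simp only: cc minus_minus)
  also have "\<dots> = - (c\<^sup>\<star> * (c * (k * k)))" by (simp only: minus_mult_left mult.assoc)
  also have "\<dots> = 0" by (simp only: ckk mult_zero_right minus_zero)
  finally have "(k * k) * (k * k) = 0" .
  then have "k * k = 0" using mult_self_eq_0[of "k * k"] k by (simp add: star_mult)
  then have "k = 0" using mult_self_eq_0 k by blast
  then have "s * s * n = 0" by (simp add: k_def mult.assoc)
  then have "n * n = 0" by (simp add: nn)
  then show "n = 0" by (rule mult_self_eq_0[OF n])
qed

lemma nonneg_conjugate:
  assumes "nonneg x" shows "nonneg (c\<^sup>\<star> * x * c)"
proof -
  obtain s where s: "nonneg s" "s * s = x" using nonneg_sqrt[OF assms] by metis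
  have "c\<^sup>\<star> * x * c = (s * c)\<^sup>\<star> * (s * c)"
    unfolding s(2)[symmetric] using s(1) by (simp add: star_mult nonneg_star mult.assoc)
  then show ?thesis using nonneg_star_mult_self[of "s * c"] by simp
qed

text \<open>
  The commuting product \<open>(r - p) (r + p) = r\<^sup>2 - p\<^sup>2\<close> is non-negative, hence a square \<open>k\<^sup>2\<close> with \<open>p\<^sup>2 + k\<^sup>2 = r\<^sup>2\<close>.
\<close>

lemma norm_le_if_nonneg:
  assumes p: "nonneg (r *\<^sub>R 1 - p)" "nonneg (r *\<^sub>R 1 + p)" and r: "r \<ge> 0" and sa: "p\<^sup>\<star> = p"
  shows "norm p \<le> r"
proof -
  have n: "nonneg ((r *\<^sub>R 1 - p) * (r *\<^sub>R 1 + p))"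
    by (rule nonneg_mult_commuting[OF p]) (simp add: algebra_simps)
  obtain k where k: "nonneg k" "k * k = (r *\<^sub>R 1 - p) * (r *\<^sub>R 1 + p)"
    "\<And>c. c * ((r *\<^sub>R 1 - p) * (r *\<^sub>R 1 + p)) = ((r *\<^sub>R 1 - p) * (r *\<^sub>R 1 + p)) * c \<Longrightarrow> c * k = k * c"
    using nonneg_sqrt[OF n] by blast
  have pk: "p * k = k * p" by (rule k(3)) (simp add: algebra_simps)
  have "norm (p * p) \<le> norm (p * p + k * k)"
    by (rule norm_square_le_sum_squares[OF sa nonneg_star[OF k(1)] pk])
  also have "p * p + k * k = (r * r) *\<^sub>R 1" by (simp add: k(2) algebra_simps)
  also have "norm ((r * r) *\<^sub>R (1::'a)) \<le> r * r"
    using mult_left_mono[OF norm_one_le[where 'a='a], of "r * r"] by simp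
  finally have "norm (p * p) \<le> r * r" .
  then have "(norm p)\<^sup>2 \<le> r\<^sup>2"
    using cstar_identity[of p] sa by (simp add: power2_eq_square)
  then show ?thesis using r by (rule power2_le_imp_le)
qed

lemma nonneg_norm_minus:
  assumes sa: "x\<^sup>\<star> = x" and r: "norm x \<le> r"
  shows "nonneg (r *\<^sub>R 1 - x)"
  unfolding nonneg_def using assms order_trans[OF norm_ge_zero r]
  by (auto simp: star_diff star_scaleR intro!: exI[of _ r])

lemma norm_mono_nonneg:
  assumes p: "nonneg p" and qp: "nonneg (q - p)"
  shows "norm p \<le> norm q"
proof (rule norm_le_if_nonneg)
  have q: "nonneg q" using nonneg_add[OF p qp] by simp
  have "nonneg (norm q *\<^sub>R 1 - q)" by (rule nonneg_norm_minus) (simp_all add: nonneg_star q)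
  from nonneg_add[OF this qp] show "nonneg (norm q *\<^sub>R 1 - p)" by simp
  have "nonneg (norm q *\<^sub>R (1::'a) )" using nonneg_norm_minus[of 0 "norm q"] by simp
  from nonneg_add[OF this p] show "nonneg (norm q *\<^sub>R 1 + p)" .
qed (use p in \<open>simp_all add: nonneg_star\<close>)

section \<open>The multiplier algebra\<close>

lift_definition scaleC_blinfun :: "complex \<Rightarrow> ('b::real_normed_vector \<Rightarrow>\<^sub>L 'a::cstar_algebra) \<Rightarrow> 'b \<Rightarrow>\<^sub>L 'a"
  is "\<lambda>c f x. c *\<^sub>C f x"
proof -
  fix c and f :: "'b \<Rightarrow> 'a"
  assume "bounded_linear f"
  then obtain K where "\<And>x. norm (f x) \<le> norm x * K" and lin: "linear f"
    using bounded_linear.bounded bounded_linear.linear by blast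
  then have "norm (c *\<^sub>C f x) \<le> norm x * (cmod c * K)" for x
    using mult_left_mono[of "norm (f x)" "norm x * K" "cmod c"]
    by (simp add: norm_scaleC mult.left_commute)
  then show "bounded_linear (\<lambda>x. c *\<^sub>C f x)"
    by (intro bounded_linear_intro[where K = "cmod c * K"])
      (use lin in \<open>auto simp: linear_add linear_scale scaleR_scaleC scaleC_simps mult.commute\<close>)
qed

lifting_forget blinfun.lifting

text \<open>
  A multiplier is an adjointable operator on \<open>A\<close>.  It is carried together with its adjoint, so that the involution
  is the exchange of the two components; the first component determines the second (\<open>multiplier_eqI\<close>).
\<close>

typedef (overloaded) ('a::cstar_algebra) multiplier =
  "{p :: ('a \<Rightarrow>\<^sub>L 'a) \<times> ('a \<Rightarrow>\<^sub>L 'a). \<forall>x y. (fst p x)\<^sup>\<star> * y = x\<^sup>\<star> * snd p y}"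
  by (rule exI[of _ "(0, 0)"]) simp

setup_lifting type_definition_multiplier

lift_definition mapply :: "'a::cstar_algebra multiplier \<Rightarrow> 'a \<Rightarrow>\<^sub>L 'a" is fst .

lift_definition madj :: "'a::cstar_algebra multiplier \<Rightarrow> 'a \<Rightarrow>\<^sub>L 'a" is snd .

lemma madj: "(mapply T x)\<^sup>\<star> * y = x\<^sup>\<star> * madj T y"
  by transfer auto

lemma cancel_left: "(\<And>x. x\<^sup>\<star> * y = 0) \<Longrightarrow> (y::'a::cstar_algebra) = 0"
  using star_mult_self_eq_0 by blast

lemma multiplier_eqI:
  assumes "mapply T = mapply T'" shows "T = T'"
proof -
  have "madj T y - madj T' y = 0" for y
    by (rule cancel_left) (simp add: algebra_simps assms flip: madj)
  then have "madj T = madj T'" by (intro blinfun_eqI) simp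
  with assms show ?thesis by transfer (auto simp: prod_eq_iff)
qed

lemma multiplier_ext:
  assumes "\<And>x. mapply T x = mapply T' x" shows "T = T'"
  by (rule multiplier_eqI) (rule blinfun_eqI, rule assms)

text \<open>
  For \<open>z = T\<^sup>\<star> y\<close> one has \<open>z\<^sup>\<star> z = (T z)\<^sup>\<star> y\<close>.  Hence a Cauchy sequence of multipliers has a Cauchy sequence of
  adjoints, and the multiplier algebra is complete.
\<close>

lemma norm_madj_le: "norm (madj T) \<le> norm (mapply T)"
proof (rule norm_blinfun_bound)
  fix y
  let ?z = "madj T y"
  have "norm ?z * norm ?z = norm ((mapply T ?z)\<^sup>\<star> * y)"
    using cstar_identity[of ?z] by (simp add: madj power2_eq_square)
  also have "\<dots> \<le> (norm (mapply T) * norm ?z) * norm y"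
    by (rule order_trans[OF norm_mult_ineq mult_right_mono]) (simp_all add: norm_blinfun)
  finally show "norm ?z \<le> norm (mapply T) * norm y"
    by (cases "?z = 0") (auto simp: mult.assoc mult.left_commute[of _ "norm ?z"] mult_le_cancel_left)
qed simp

instantiation multiplier :: (cstar_algebra) real_normed_algebra
begin

lift_definition zero_multiplier :: "'a multiplier" is "(0, 0)" by simp

lift_definition plus_multiplier :: "'a multiplier \<Rightarrow> 'a multiplier \<Rightarrow> 'a multiplier"
  is "\<lambda>(T, S) (T', S'). (T + T', S + S')"
  by (auto simp: blinfun.add_left star_add algebra_simps)

lift_definition minus_multiplier :: "'a multiplier \<Rightarrow> 'a multiplier \<Rightarrow> 'a multiplier"
  is "\<lambda>(T, S) (T', S'). (T - T', S - S')"
  by (auto simp: blinfun.diff_left star_diff algebra_simps)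

lift_definition uminus_multiplier :: "'a multiplier \<Rightarrow> 'a multiplier"
  is "\<lambda>(T, S). (- T, - S)"
  by (auto simp: blinfun.minus_left star_minus)

lift_definition times_multiplier :: "'a multiplier \<Rightarrow> 'a multiplier \<Rightarrow> 'a multiplier"
  is "\<lambda>(T, S) (T', S'). (T o\<^sub>L T', S' o\<^sub>L S)"
  by auto

lift_definition scaleR_multiplier :: "real \<Rightarrow> 'a multiplier \<Rightarrow> 'a multiplier"
  is "\<lambda>r (T, S). (r *\<^sub>R T, r *\<^sub>R S)"
  by (auto simp: blinfun.scaleR_left star_scaleR)

definition norm_multiplier :: "'a multiplier \<Rightarrow> real" where
  "norm_multiplier T = norm (mapply T)"

definition dist_multiplier :: "'a multiplier \<Rightarrow> 'a multiplier \<Rightarrow> real" where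
  "dist_multiplier T T' = norm (T - T')"

definition sgn_multiplier :: "'a multiplier \<Rightarrow> 'a multiplier" where
  "sgn_multiplier T = inverse (norm T) *\<^sub>R T"

definition uniformity_multiplier :: "('a multiplier \<times> 'a multiplier) filter" where
  "uniformity_multiplier = (INF e\<in>{0<..}. principal {(T, T'). dist T T' < e})"

definition open_multiplier :: "'a multiplier set \<Rightarrow> bool" where
  "open_multiplier U \<longleftrightarrow> (\<forall>T\<in>U. eventually (\<lambda>(T', T''). T' = T \<longrightarrow> T'' \<in> U) uniformity)"

lemma mapply_simps:
  "mapply (0::'a multiplier) = 0"
  "mapply (T + T' :: 'a multiplier) = mapply T + mapply T'"
  "mapply (T - T' :: 'a multiplier) = mapply T - mapply T'"
  "mapply (- T :: 'a multiplier) = - mapply T"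
  "mapply (T * T' :: 'a multiplier) = mapply T o\<^sub>L mapply T'"
  "mapply (r *\<^sub>R T :: 'a multiplier) = r *\<^sub>R mapply T"
  by (transfer, auto)+

lemma mapply_app:
  "mapply (0::'a multiplier) x = 0"
  "mapply (T + T' :: 'a multiplier) x = mapply T x + mapply T' x"
  "mapply (T - T' :: 'a multiplier) x = mapply T x - mapply T' x"
  "mapply (- T :: 'a multiplier) x = - mapply T x"
  "mapply (T * T' :: 'a multiplier) x = mapply T (mapply T' x)"
  "mapply (r *\<^sub>R T :: 'a multiplier) x = r *\<^sub>R mapply T x"
  by (simp_all add: mapply_simps blinfun.add_left blinfun.diff_left blinfun.minus_left
      blinfun.scaleR_left)

instance
proof
  fix a b c :: "'a multiplier" and r s :: real
  show "a + b + c = a + (b + c)" "a + b = b + a" "0 + a = a" "- a + a = 0" "a - b = a + - b"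
    "r *\<^sub>R (a + b) = r *\<^sub>R a + r *\<^sub>R b" "(r + s) *\<^sub>R a = r *\<^sub>R a + s *\<^sub>R a"
    "r *\<^sub>R s *\<^sub>R a = (r * s) *\<^sub>R a" "1 *\<^sub>R a = a" "a * b * c = a * (b * c)"
    "(a + b) * c = a * c + b * c" "a * (b + c) = a * b + a * c"
    "(r *\<^sub>R a) * b = r *\<^sub>R (a * b)" "a * (r *\<^sub>R b) = r *\<^sub>R (a * b)"
    by (auto intro!: multiplier_ext
        simp: mapply_app algebra_simps blinfun.add_right blinfun.scaleR_right)
  show "norm (a + b) \<le> norm a + norm b" "norm (r *\<^sub>R a) = \<bar>r\<bar> * norm a" "norm (a * b) \<le> norm a * norm b"
    by (simp_all add: norm_multiplier_def mapply_simps norm_triangle_ineq norm_blinfun_compose)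
  show "(norm a = 0) = (a = 0)"
    by (auto simp: norm_multiplier_def mapply_simps intro: multiplier_eqI)
  show "dist a b = norm (a - b)" "sgn a = inverse (norm a) *\<^sub>R a"
    by (simp_all add: dist_multiplier_def sgn_multiplier_def)
  show "uniformity = (INF e\<in>{0<..}. principal {(x, y :: 'a multiplier). dist x y < e})"
    by (rule uniformity_multiplier_def)
  show "open U = (\<forall>x\<in>U. \<forall>\<^sub>F (x', y) in uniformity. x' = x \<longrightarrow> y \<in> U)" for U :: "'a multiplier set"
    by (rule open_multiplier_def)
qed

end

lemma madj_diff: "madj (T - T') = madj T - madj T'"
  by (transfer, auto)

lemma Cauchy_multiplier_convergent:
  fixes X :: "nat \<Rightarrow> 'a::cstar_algebra multiplier"
  assumes X: "Cauchy X"
  shows "convergent X"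
proof -
  have "Cauchy (\<lambda>n. mapply (X n))"
    by (rule CauchyI) (use CauchyD[OF X] in \<open>simp add: norm_multiplier_def mapply_simps\<close>)
  then obtain T where T: "(\<lambda>n. mapply (X n)) \<longlonglongrightarrow> T" by (auto simp: Cauchy_convergent_iff convergent_def)
  have "Cauchy (\<lambda>n. madj (X n))"
  proof (rule CauchyI)
    fix e :: real assume "e > 0"
    from CauchyD[OF X this] obtain M where M: "\<forall>m\<ge>M. \<forall>n\<ge>M. norm (X m - X n) < e" by blast
    have "norm (madj (X m) - madj (X n)) < e" if "m \<ge> M" "n \<ge> M" for m n
    proof -
      have "norm (X m - X n) < e" using M that by blast
      then show ?thesis
        using norm_madj_le[of "X m - X n"] by (simp add: norm_multiplier_def madj_diff)
    qed
    then show "\<exists>M. \<forall>m\<ge>M. \<forall>n\<ge>M. norm (madj (X m) - madj (X n)) < e" by blast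
  qed
  then obtain S where S: "(\<lambda>n. madj (X n)) \<longlonglongrightarrow> S" by (auto simp: Cauchy_convergent_iff convergent_def)
  have TS: "(T x)\<^sup>\<star> * y = x\<^sup>\<star> * S y" for x y
  proof (rule LIMSEQ_unique)
    show "(\<lambda>n. (mapply (X n) x)\<^sup>\<star> * y) \<longlonglongrightarrow> (T x)\<^sup>\<star> * y"
      by (intro tendsto_intros tendsto_star blinfun.tendsto[OF T])
    show "(\<lambda>n. (mapply (X n) x)\<^sup>\<star> * y) \<longlonglongrightarrow> x\<^sup>\<star> * S y"
      unfolding madj by (intro tendsto_intros blinfun.tendsto[OF S])
  qed
  define Q where "Q = Abs_multiplier (T, S)"
  have Q: "mapply Q = T"
    unfolding Q_def mapply.rep_eq by (subst Abs_multiplier_inverse) (simp_all add: TS)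
  have "X \<longlonglongrightarrow> Q"
    by (rule LIMSEQ_I) (use LIMSEQ_D[OF T] in \<open>simp add: norm_multiplier_def mapply_simps Q\<close>)
  then show ?thesis by (auto simp: convergent_def)
qed

instance multiplier :: (cstar_algebra) banach
  by standard (rule Cauchy_multiplier_convergent)

instantiation multiplier :: (cstar_algebra) unital_cstar_algebra
begin

lift_definition one_multiplier :: "'a multiplier" is "(id_blinfun, id_blinfun)" by simp

lift_definition scaleC_multiplier :: "complex \<Rightarrow> 'a multiplier \<Rightarrow> 'a multiplier"
  is "\<lambda>c (T, S). (scaleC_blinfun c T, scaleC_blinfun (cnj c) S)"
  by (auto simp: scaleC_blinfun.rep_eq star_scaleC mult_scaleC_left mult_scaleC_right)

lift_definition star_multiplier :: "'a multiplier \<Rightarrow> 'a multiplier"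
  is "\<lambda>(T, S). (S, T)"
proof (clarsimp, goal_cases)
  case (1 T S x y)
  then have "((T y)\<^sup>\<star> * x)\<^sup>\<star> = (y\<^sup>\<star> * S x)\<^sup>\<star>" by simp
  then show ?case by (simp add: star_mult star_star)
qed

lemma mapply_star: "mapply (T\<^sup>\<star> :: 'a multiplier) = madj T"
  by (transfer, auto)

lemma madj_star: "madj (T\<^sup>\<star> :: 'a multiplier) = mapply T"
  by (transfer, auto)

lemma mapply_scaleC: "mapply (c *\<^sub>C T :: 'a multiplier) = scaleC_blinfun c (mapply T)"
  by (transfer, auto)

lemma mapply_scaleC_app: "mapply (c *\<^sub>C T :: 'a multiplier) x = c *\<^sub>C mapply T x"
  by (simp add: mapply_scaleC scaleC_blinfun.rep_eq)

lemma mapply_one: "mapply (1 :: 'a multiplier) x = x"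
  by (transfer, auto)

lemma madj_app:
  "madj (T + T' :: 'a multiplier) x = madj T x + madj T' x"
  "madj (T * T' :: 'a multiplier) x = madj T' (madj T x)"
  "madj (c *\<^sub>C T :: 'a multiplier) x = cnj c *\<^sub>C madj T x"
  by (transfer, auto simp: blinfun.add_left scaleC_blinfun.rep_eq)+

text \<open>
  The components are only required to be real linear; complex linearity, like compatibility with right
  multiplication, follows from the existence of an adjoint.
\<close>

lemma mapply_scaleC_right: "mapply (T :: 'a multiplier) (k *\<^sub>C x) = k *\<^sub>C mapply T x"
proof -
  have "y\<^sup>\<star> * (mapply T (k *\<^sub>C x) - k *\<^sub>C mapply T x) = 0" for y
    using madj[of "T\<^sup>\<star>" y "k *\<^sub>C x"] madj[of "T\<^sup>\<star>" y x]
    by (simp add: madj_star mapply_star algebra_simps mult_scaleC_right)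
  from cancel_left[OF this] show ?thesis by simp
qed

instance
proof
  fix a b c :: "'a multiplier" and r :: real and k l :: complex
  show "k *\<^sub>C (a + b) = k *\<^sub>C a + k *\<^sub>C b" "(k + l) *\<^sub>C a = k *\<^sub>C a + l *\<^sub>C a"
    "k *\<^sub>C l *\<^sub>C a = (k * l) *\<^sub>C a" "1 *\<^sub>C a = a"
    "1 * a = a" "a * 1 = a" "r *\<^sub>R a = complex_of_real r *\<^sub>C a"
    by (auto intro!: multiplier_ext
        simp: mapply_app mapply_one mapply_scaleC_app scaleC_simps scaleC_add_left scaleR_scaleC)
  show "(k *\<^sub>C a) * b = k *\<^sub>C (a * b)" "a * (k *\<^sub>C b) = k *\<^sub>C (a * b)"
    by (auto intro!: multiplier_ext simp: mapply_app mapply_scaleC_app mapply_scaleC_right)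
  show "(a\<^sup>\<star>)\<^sup>\<star> = a" "(a + b)\<^sup>\<star> = a\<^sup>\<star> + b\<^sup>\<star>" "(k *\<^sub>C a)\<^sup>\<star> = cnj k *\<^sub>C a\<^sup>\<star>" "(a * b)\<^sup>\<star> = b\<^sup>\<star> * a\<^sup>\<star>"
    by (auto intro!: multiplier_ext simp: mapply_app mapply_scaleC_app mapply_star madj_app madj_star)
  show "norm (k *\<^sub>C a) = cmod k * norm a"
  proof (cases "k = 0")
    case True
    have "scaleC_blinfun 0 (mapply a) = 0"
      by (rule blinfun_eqI) (simp add: scaleC_blinfun.rep_eq)
    with True show ?thesis by (simp add: norm_multiplier_def mapply_scaleC)
  next
    case False
    have le: "norm (scaleC_blinfun k T) \<le> cmod k * norm T" for k and T :: "'a \<Rightarrow>\<^sub>L 'a"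
      by (rule norm_blinfun_bound)
        (auto simp: scaleC_blinfun.rep_eq norm_scaleC mult.assoc intro!: mult_left_mono norm_blinfun)
    have "scaleC_blinfun (1/k) (scaleC_blinfun k (mapply a)) = mapply a"
      by (rule blinfun_eqI) (use False in \<open>simp add: scaleC_blinfun.rep_eq scaleC_simps\<close>)
    then have "norm (mapply a) \<le> cmod (1/k) * norm (scaleC_blinfun k (mapply a))" by (metis le)
    then have "cmod k * norm (mapply a) \<le> norm (scaleC_blinfun k (mapply a))"
      using False by (simp add: norm_divide field_simps)
    with le[of k "mapply a"] show ?thesis by (simp add: norm_multiplier_def mapply_simps mapply_star mapply_scaleC)
  qed
  show "norm (a\<^sup>\<star> * a) = (norm a)\<^sup>2"
  proof (rule antisym)
    show "norm (a\<^sup>\<star> * a) \<le> (norm a)\<^sup>2"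
      unfolding norm_multiplier_def mapply_simps mapply_star power2_eq_square
      by (rule order_trans[OF norm_blinfun_compose mult_right_mono[OF norm_madj_le]]) simp
    have "norm (mapply a x) \<le> sqrt (norm (a\<^sup>\<star> * a)) * norm x" for x
    proof -
      have "(norm (mapply a x))\<^sup>2 = norm (x\<^sup>\<star> * mapply (a\<^sup>\<star> * a) x)"
        using cstar_identity[of "mapply a x"] by (simp add: madj mapply_simps mapply_star)
      also have "\<dots> \<le> norm x * (norm (a\<^sup>\<star> * a) * norm x)"
        unfolding norm_multiplier_def
        using order_trans[OF norm_mult_ineq[of "x\<^sup>\<star>"] mult_left_mono[OF norm_blinfun]]
        by simp
      also have "\<dots> = (sqrt (norm (a\<^sup>\<star> * a)) * norm x)\<^sup>2"
        by (simp add: norm_multiplier_def power_mult_distrib) (simp add: power2_eq_square)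
      finally show ?thesis by (rule power2_le_imp_le) (simp add: norm_multiplier_def)
    qed
    moreover have nn: "0 \<le> norm (a\<^sup>\<star> * a)" by (simp add: norm_multiplier_def)
    ultimately have "norm a \<le> sqrt (norm (a\<^sup>\<star> * a))"
      unfolding norm_multiplier_def[of a] by (intro norm_blinfun_bound) simp_all
    then have "(norm a)\<^sup>2 \<le> (sqrt (norm (a\<^sup>\<star> * a)))\<^sup>2"
      by (rule power_mono) (simp add: norm_multiplier_def)
    then show "(norm a)\<^sup>2 \<le> norm (a\<^sup>\<star> * a)" using nn by simp
  qed
qed

end


lift_definition lmul :: "'a::cstar_algebra \<Rightarrow> 'a multiplier"
  is "\<lambda>a. (Blinfun (\<lambda>x. a * x), Blinfun (\<lambda>x. a\<^sup>\<star> * x))"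
  by (simp add: bounded_linear_Blinfun_apply bounded_linear_mult_right star_mult mult.assoc)

lemma mapply_lmul [simp]: "mapply (lmul a) x = a * x"
  by transfer (simp add: bounded_linear_Blinfun_apply bounded_linear_mult_right)

lemma mapply_star_app: "(mapply T x)\<^sup>\<star> * y = x\<^sup>\<star> * mapply (T\<^sup>\<star>) y"
  by (simp add: madj mapply_star)

lemma mapply_mult_right: "mapply T (x * a) = mapply T x * a"
proof -
  have "y\<^sup>\<star> * (mapply T (x * a) - mapply T x * a) = 0" for y
    using mapply_star_app[of "T\<^sup>\<star>" y "x * a"] mapply_star_app[of "T\<^sup>\<star>" y x]
    by (simp add: star_star algebra_simps flip: mult.assoc)
  from cancel_left[OF this] show ?thesis by simp
qed

lemma lmul_add: "lmul (a + b) = lmul a + lmul b"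
  and lmul_diff: "lmul (a - b) = lmul a - lmul b"
  and lmul_mult: "lmul (a * b) = lmul a * lmul b"
  and lmul_scaleR: "lmul (r *\<^sub>R a) = r *\<^sub>R lmul a"
  by (rule multiplier_ext, simp add: mapply_app algebra_simps)+

lemma lmul_star: "lmul (a\<^sup>\<star>) = (lmul a)\<^sup>\<star>"
proof (rule multiplier_ext)
  fix x
  have "y\<^sup>\<star> * (a\<^sup>\<star> * x - mapply ((lmul a)\<^sup>\<star>) x) = 0" for y
    using mapply_star_app[of "lmul a" y x] by (simp add: star_mult algebra_simps)
  from cancel_left[OF this] show "mapply (lmul (a\<^sup>\<star>)) x = mapply ((lmul a)\<^sup>\<star>) x" by simp
qed

lemma norm_lmul: "norm (lmul a) = norm a"
proof (rule antisym)
  show "norm (lmul a) \<le> norm a"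
    unfolding norm_multiplier_def by (rule norm_blinfun_bound) (simp_all add: norm_mult_ineq)
  have "norm (a * a\<^sup>\<star>) \<le> norm (lmul a) * norm a"
    using norm_blinfun[of "mapply (lmul a)" "a\<^sup>\<star>"] by (simp add: norm_multiplier_def)
  moreover have "norm (a * a\<^sup>\<star>) = norm a * norm a"
    using cstar_identity[of "a\<^sup>\<star>"] by (simp add: star_star power2_eq_square)
  ultimately show "norm a \<le> norm (lmul a)"
    by (cases "a = 0") (simp_all add: mult_le_cancel_right)
qed

lemma lmul_eq_iff: "lmul a = lmul b \<longleftrightarrow> a = b"
  using norm_lmul[of "a - b"] by (auto simp: lmul_diff)

lemma selfadjoint_lmul: "(lmul a)\<^sup>\<star> = lmul a \<longleftrightarrow> a\<^sup>\<star> = a"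
  by (metis lmul_eq_iff lmul_star)

lemma bounded_linear_lmul: "bounded_linear lmul"
  by (rule bounded_linear_intro[where K = 1]) (simp_all add: lmul_add lmul_scaleR norm_lmul)

text \<open>
  The iterates at an element of \<open>A\<close> leave \<open>A\<close> only by a multiple of the unit, and the factor
  \<open>1 - sqrt_bound n\<close> tends to zero.  So the square root of a non-negative element of \<open>A\<close>, taken among the multipliers,
  lies in \<open>A\<close>.
\<close>

lemma sqrt_iter_lmul:
  "\<exists>b. sqrt_iter (lmul a) n = (1 - sqrt_bound n) *\<^sub>R 1 + lmul b"
proof (induction n)
  case 0
  show ?case by (rule exI[of _ 0]) (simp add: linear_simps[OF bounded_linear_lmul])
next
  case (Suc n)
  then obtain b where b: "sqrt_iter (lmul a) n = (1 - sqrt_bound n) *\<^sub>R 1 + lmul b" by blast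
  define k where "k = 1 - sqrt_bound n"
  have sq: "(k *\<^sub>R 1 + lmul b) * (k *\<^sub>R 1 + lmul b)
      = (k * k) *\<^sub>R 1 + (2 * k) *\<^sub>R lmul b + lmul (b * b)"
    unfolding mult_2 scaleR_left_distrib
    by (simp add: distrib_left distrib_right lmul_mult scaleR_right_distrib)
  have "sqrt_iter (lmul a) (Suc n)
    = (k - k * k / 2) *\<^sub>R 1 + lmul (b + (1/2) *\<^sub>R (a - (2 * k) *\<^sub>R b - b * b))"
    unfolding sqrt_iter.simps b k_def[symmetric] sq
    by (simp add: lmul_add lmul_diff lmul_scaleR scaleR_right_diff_distrib scaleR_right_distrib
        scaleR_left_diff_distrib)
  moreover have "k - k * k / 2 = 1 - sqrt_bound (Suc n)"
    by (simp add: k_def power2_eq_square field_simps)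
  ultimately show ?case by metis
qed

lemma positive_iff_nonneg: "positive a \<longleftrightarrow> nonneg (lmul a)"
proof
  assume "positive a"
  then obtain b where "a = b\<^sup>\<star> * b" by (auto simp: positive_def)
  then show "nonneg (lmul a)" by (simp add: lmul_mult lmul_star nonneg_star_mult_self)
next
  assume nn: "nonneg (lmul a)"
  then obtain r where r: "norm (r *\<^sub>R 1 - lmul a) \<le> r" by (auto simp: nonneg_def)
  define t where "t = max r 1"
  have t: "t > 0" by (simp add: t_def)
  have "norm (1 - lmul ((1/t) *\<^sub>R a)) \<le> 1"
    using radius_rescale[OF radius_mono[OF r, of t] t] by (simp add: t_def lmul_scaleR)
  moreover have "(lmul ((1/t) *\<^sub>R a))\<^sup>\<star> = lmul ((1/t) *\<^sub>R a)"
    using nonneg_star[OF nn] by (simp add: lmul_scaleR star_scaleR)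
  ultimately obtain s where s: "sqrt_iter (lmul ((1/t) *\<^sub>R a)) \<longlonglongrightarrow> s" "nonneg s"
    "s * s = lmul ((1/t) *\<^sub>R a)" using sqrt_iter_limit by blast
  from sqrt_iter_lmul[of "(1/t) *\<^sub>R a"] obtain b where
    b: "\<And>n. sqrt_iter (lmul ((1/t) *\<^sub>R a)) n = (1 - sqrt_bound n) *\<^sub>R 1 + lmul (b n)" by metis
  have "(\<lambda>n. sqrt_iter (lmul ((1/t) *\<^sub>R a)) n - (1 - sqrt_bound n) *\<^sub>R 1) \<longlonglongrightarrow> s - (1 - 1) *\<^sub>R 1"
    by (intro tendsto_intros s sqrt_bound_tendsto)
  then have lim: "(\<lambda>n. lmul (b n)) \<longlonglongrightarrow> s" by (simp add: b)
  have "Cauchy b"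
    by (rule CauchyI)
      (use CauchyD[OF LIMSEQ_imp_Cauchy[OF lim]] in \<open>simp add: norm_lmul flip: lmul_diff\<close>)
  then obtain c where "b \<longlonglongrightarrow> c" by (auto simp: Cauchy_convergent_iff convergent_def)
  from LIMSEQ_unique[OF lim bounded_linear.tendsto[OF bounded_linear_lmul this]] have sc: "s = lmul c" .
  then have "c\<^sup>\<star> = c" using nonneg_star[OF s(2)] by (simp add: selfadjoint_lmul)
  moreover have "c * c = (1/t) *\<^sub>R a" using s(3) by (simp add: sc lmul_eq_iff flip: lmul_mult)
  ultimately have "a = (sqrt t *\<^sub>R c)\<^sup>\<star> * (sqrt t *\<^sub>R c)" using t by (simp add: star_scaleR)
  then show "positive a" unfolding positive_def by blast
qed

lemma positive_star: "positive a \<Longrightarrow> a\<^sup>\<star> = a"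
  by (auto simp: positive_def star_mult star_star)

lemma positive_LIMSEQ:
  assumes "\<And>n. positive (X n)" "X \<longlonglongrightarrow> x" shows "positive x"
  unfolding positive_iff_nonneg
  by (rule nonneg_LIMSEQ[of "\<lambda>n. lmul (X n)"])
    (use assms in \<open>auto simp: positive_iff_nonneg intro: bounded_linear.tendsto[OF bounded_linear_lmul]\<close>)

section \<open>Essential right ideals\<close>

lemma right_idealD:
  assumes "right_ideal I"
  shows "0 \<in> I" "x \<in> I \<Longrightarrow> y \<in> I \<Longrightarrow> x + y \<in> I" "x \<in> I \<Longrightarrow> c *\<^sub>C x \<in> I" "x \<in> I \<Longrightarrow> x * a \<in> I"
  using assms by (auto simp: right_ideal_def complex_subspace_def)

lemma essential_idealD:
  assumes "essential_closed_right_ideal J"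
  shows "right_ideal J" "closed J" "right_ideal I \<Longrightarrow> I \<noteq> {0} \<Longrightarrow> J \<inter> I \<noteq> {0}"
  using assms by (auto simp: essential_closed_right_ideal_def)

lemma essential_ideal_meets:
  assumes J: "essential_closed_right_ideal J" and I: "right_ideal I" and y: "y \<in> I" "y \<noteq> 0"
  obtains x where "x \<in> J" "x \<in> I" "x \<noteq> 0"
proof -
  have "I \<noteq> {0}" using y by blast
  then have "J \<inter> I \<noteq> {0}" by (rule essential_idealD(3)[OF J I])
  moreover have "0 \<in> J \<inter> I" using right_idealD(1) essential_idealD(1)[OF J] I by blast
  ultimately show thesis using that by blast
qed

text \<open>
  If \<open>b \<noteq> 0\<close>, then \<open>J\<close> meets the right ideal \<open>b\<^sup>\<star> A\<close> in some \<open>b\<^sup>\<star> a \<noteq> 0\<close>, but \<open>(b\<^sup>\<star> a)\<^sup>\<star> (b\<^sup>\<star> a) = a\<^sup>\<star> b (b\<^sup>\<star> a) = 0\<close>.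
\<close>

lemma essential_ideal_cancel:
  assumes J: "essential_closed_right_ideal J" and b: "\<And>x. x \<in> J \<Longrightarrow> b * x = 0"
  shows "b = 0"
proof (rule ccontr)
  assume "b \<noteq> 0"
  let ?I = "range (\<lambda>a. b\<^sup>\<star> * a)"
  have "right_ideal ?I"
    unfolding right_ideal_def complex_subspace_def
  proof (safe)
    show "0 \<in> ?I" by (rule range_eqI[of _ _ 0]) simp
    show "b\<^sup>\<star> * x + b\<^sup>\<star> * y \<in> ?I" for x y by (rule range_eqI[of _ _ "x + y"]) (simp add: algebra_simps)
    show "c *\<^sub>C (b\<^sup>\<star> * x) \<in> ?I" for c x by (rule range_eqI[of _ _ "c *\<^sub>C x"]) (simp add: mult_scaleC_right)
    show "b\<^sup>\<star> * x * y \<in> ?I" for x y by (rule range_eqI[of _ _ "x * y"]) (simp add: mult.assoc)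
  qed
  moreover have "b\<^sup>\<star> * b \<in> ?I" "b\<^sup>\<star> * b \<noteq> 0" using \<open>b \<noteq> 0\<close> by auto
  ultimately obtain a where a: "b\<^sup>\<star> * a \<in> J" "b\<^sup>\<star> * a \<noteq> 0"
    using essential_ideal_meets[OF J] by blast
  then have "(b\<^sup>\<star> * a)\<^sup>\<star> * (b\<^sup>\<star> * a) = 0"
    using b[OF a(1)] by (simp add: star_mult star_star mult.assoc)
  with a(2) show False by simp
qed

lemma essential_ideal_cancel_star:
  assumes J: "essential_closed_right_ideal J" and b: "\<And>x. x \<in> J \<Longrightarrow> x\<^sup>\<star> * b = 0"
  shows "b = 0"
proof -
  have "b\<^sup>\<star> * x = 0" if "x \<in> J" for x
    using b[OF that] by (metis star_mult star_star star_zero)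
  from essential_ideal_cancel[OF J this] show ?thesis by (metis star_star star_zero)
qed

text \<open>
  If the negative part \<open>n / 2\<close> of \<open>T\<close> did not vanish, \<open>J\<close> would contain some \<open>x = n b \<noteq> 0\<close>.  On such an \<open>x\<close> the operator
  \<open>T\<close> acts as \<open>- s\<^sup>2\<close>, so excluding this behaviour on \<open>J\<close>, unless \<open>s x = 0\<close>, suffices for \<open>T \<ge> 0\<close>:
  if \<open>s x = 0\<close>, then \<open>n\<^sup>2 b = 2 s\<^sup>2 n b = 0\<close>, and \<open>n b = 0\<close> after all.
\<close>

lemma nonneg_if_nonneg_on_essential:
  assumes J: "essential_closed_right_ideal J" and T: "T\<^sup>\<star> = T"
    and neg: "\<And>x s. x \<in> J \<Longrightarrow> s\<^sup>\<star> = s \<Longrightarrow> mapply T x = - mapply s (mapply s x) \<Longrightarrow> mapply s x = 0"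
  shows "nonneg T"
proof (rule nonneg_if_no_negative_part[OF T])
  fix n s :: "'a multiplier"
  assume n: "n\<^sup>\<star> = n" and s: "s\<^sup>\<star> = s" and Tn: "T * n = - (s * s * n)"
    and nn: "n * n = 2 *\<^sub>R (s * s * n)"
  show "n = 0"
  proof (rule ccontr)
    assume "n \<noteq> 0"
    let ?I = "range (mapply n)"
    have "right_ideal ?I"
      unfolding right_ideal_def complex_subspace_def
    proof (safe)
      show "0 \<in> ?I" by (rule range_eqI[of _ _ 0]) simp
      show "mapply n x + mapply n y \<in> ?I" for x y
        by (rule range_eqI[of _ _ "x + y"]) (simp add: blinfun.add_right)
      show "c *\<^sub>C mapply n x \<in> ?I" for c x
        by (rule range_eqI[of _ _ "c *\<^sub>C x"]) (simp add: mapply_scaleC_right)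
      show "mapply n x * y \<in> ?I" for x y by (rule range_eqI[of _ _ "x * y"]) (simp add: mapply_mult_right)
    qed
    moreover from \<open>n \<noteq> 0\<close> obtain b where "mapply n b \<noteq> 0"
      using multiplier_ext[of n 0] by (auto simp: mapply_app)
    ultimately obtain b where b: "mapply n b \<in> J" "mapply n b \<noteq> 0"
      using essential_ideal_meets[OF J] by blast
    have "mapply T (mapply n b) = - mapply s (mapply s (mapply n b))"
      using arg_cong[OF Tn, of "\<lambda>R. mapply R b"] by (simp add: mapply_app)
    from neg[OF b(1) s this] have "mapply (n * n) b = 0" unfolding nn by (simp add: mapply_app)
    then have "(mapply n b)\<^sup>\<star> * mapply n b = 0"
      by (simp only: mapply_star_app n mapply_app mult_zero_right)
    with b(2) show False by simp
  qed
qed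

lemma positive_if_positive_on_essential:
  assumes J: "essential_closed_right_ideal J" and a: "a\<^sup>\<star> = a"
    and pos: "\<And>x. x \<in> J \<Longrightarrow> positive (x\<^sup>\<star> * a * x)"
  shows "positive a"
  unfolding positive_iff_nonneg
proof (rule nonneg_if_nonneg_on_essential[OF J])
  show "(lmul a)\<^sup>\<star> = lmul a" by (simp add: selfadjoint_lmul a)
  fix x s assume x: "x \<in> J" and s: "s\<^sup>\<star> = s" and e: "mapply (lmul a) x = - mapply s (mapply s x)"
  let ?y = "mapply s x"
  have "x\<^sup>\<star> * a * x = - (?y\<^sup>\<star> * ?y)" using e by (simp add: mult.assoc mapply_star_app s)
  then have "nonneg (- lmul (?y\<^sup>\<star> * ?y))"
    using pos[OF x] by (simp add: positive_iff_nonneg linear_simps[OF bounded_linear_lmul])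
  moreover have "nonneg (lmul (?y\<^sup>\<star> * ?y))" by (simp add: lmul_mult lmul_star nonneg_star_mult_self)
  ultimately have "lmul (?y\<^sup>\<star> * ?y) = 0" by (rule nonneg_antisym[rotated])
  then have "norm (?y\<^sup>\<star> * ?y) = 0" by (metis norm_lmul norm_zero)
  then show "?y = 0" by simp
qed

lemma norm_mono_positive:
  fixes x y :: "'a::cstar_algebra"
  assumes "positive (b - a)" "positive a" shows "norm a \<le> norm b"
  using norm_mono_nonneg[of "lmul a" "lmul b"] assms
  by (simp add: positive_iff_nonneg lmul_diff norm_lmul)

text \<open>
  The positivity criterion is applied to \<open>L - a\<close> and \<open>L + a\<close> for all \<open>L > K\<close>.  If \<open>L - c\<close> acts as \<open>- s\<^sup>2\<close> on \<open>x\<close>, then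
  \<open>x\<^sup>\<star> c x = L x\<^sup>\<star> x + (s x)\<^sup>\<star> (s x)\<close> has norm at least \<open>L \<parallel>x\<parallel>\<^sup>2\<close>; as this is at most \<open>K \<parallel>x\<parallel>\<^sup>2\<close>, it
  forces \<open>x = 0\<close>.
\<close>

lemma norm_le_if_on_essential:
  assumes J: "essential_closed_right_ideal J" and a: "a\<^sup>\<star> = a" and K: "K \<ge> 0"
    and bound: "\<And>x. x \<in> J \<Longrightarrow> norm (x\<^sup>\<star> * a * x) \<le> K * (norm x)\<^sup>2"
  shows "norm a \<le> K"
proof (rule field_le_epsilon)
  fix e :: real assume e: "e > 0"
  let ?L = "K + e"
  have main: "nonneg (?L *\<^sub>R 1 - lmul c)" if c: "c\<^sup>\<star> = c"
    and bd: "\<And>x. x \<in> J \<Longrightarrow> norm (x\<^sup>\<star> * c * x) \<le> K * (norm x)\<^sup>2" for c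
  proof (rule nonneg_if_nonneg_on_essential[OF J])
    show "(?L *\<^sub>R 1 - lmul c)\<^sup>\<star> = ?L *\<^sub>R 1 - lmul c"
      using c by (simp add: star_diff star_scaleR flip: lmul_star)
    fix x s assume x: "x \<in> J" and s: "s\<^sup>\<star> = s"
      and eq: "mapply (?L *\<^sub>R 1 - lmul c) x = - mapply s (mapply s x)"
    let ?y = "mapply s x"
    have "c * x = ?L *\<^sub>R x + mapply s ?y" using eq by (simp add: mapply_app mapply_one algebra_simps)
    then have cx: "x\<^sup>\<star> * c * x = ?L *\<^sub>R (x\<^sup>\<star> * x) + ?y\<^sup>\<star> * ?y"
      by (simp add: mult.assoc mapply_star_app s distrib_left)
    have "norm (?L *\<^sub>R (x\<^sup>\<star> * x)) \<le> norm (x\<^sup>\<star> * c * x)"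
    proof (rule norm_mono_positive)
      show "positive (x\<^sup>\<star> * c * x - ?L *\<^sub>R (x\<^sup>\<star> * x))" unfolding cx positive_def by auto
      have "?L *\<^sub>R (x\<^sup>\<star> * x) = (sqrt ?L *\<^sub>R x)\<^sup>\<star> * (sqrt ?L *\<^sub>R x)"
        using K e by (simp add: star_scaleR)
      then show "positive (?L *\<^sub>R (x\<^sup>\<star> * x))" unfolding positive_def by blast
    qed
    with bd[OF x] have "?L * (norm x)\<^sup>2 \<le> K * (norm x)\<^sup>2"
      using K e by (simp add: cstar_identity)
    then have "x = 0" using e by (simp add: mult_le_cancel_right)
    then show "?y = 0" by simp
  qed
  have "norm (lmul a) \<le> ?L"
  proof (rule norm_le_if_nonneg)
    show "nonneg (?L *\<^sub>R 1 - lmul a)" by (rule main[OF a bound])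
    have "nonneg (?L *\<^sub>R 1 - lmul (- a))"
      by (rule main) (use a bound in \<open>simp_all add: star_minus\<close>)
    then show "nonneg (?L *\<^sub>R 1 + lmul a)" by (simp add: linear_simps[OF bounded_linear_lmul])
  qed (use K e a in \<open>simp_all add: selfadjoint_lmul\<close>)
  then show "norm a \<le> K + e" by (simp add: norm_lmul)
qed

lemma right_ideal_Int: "right_ideal I \<Longrightarrow> right_ideal J \<Longrightarrow> right_ideal (I \<inter> J)"
  by (auto simp: right_ideal_def complex_subspace_def)

lemma essential_ideal_UNIV: "essential_closed_right_ideal UNIV"
  by (auto simp: essential_closed_right_ideal_def right_ideal_def complex_subspace_def)

lemma essential_ideal_Int:
  assumes "essential_closed_right_ideal J" "essential_closed_right_ideal K"
  shows "essential_closed_right_ideal (J \<inter> K)"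
  unfolding essential_closed_right_ideal_def
  using essential_idealD[OF assms(1)] essential_idealD[OF assms(2)]
  by (metis Int_assoc closed_Int right_ideal_Int)

text \<open>
  A right ideal \<open>I\<close> with \<open>a I = 0\<close> is contained in the preimage; otherwise \<open>a I\<close> is a non-zero right ideal, which meets \<open>J\<close>.
\<close>

lemma essential_ideal_preimage:
  fixes a :: "'a::cstar_algebra"
  assumes J: "essential_closed_right_ideal J"
  shows "essential_closed_right_ideal {x. a * x \<in> J}"
  unfolding essential_closed_right_ideal_def
proof (intro conjI allI impI)
  note ri = right_idealD[OF essential_idealD(1)[OF J]]
  show "right_ideal {x. a * x \<in> J}"
    using ri by (auto simp: right_ideal_def complex_subspace_def distrib_left mult_scaleC_right
        simp flip: mult.assoc)
  have "isCont (\<lambda>x. a * x) x" for x by (intro continuous_intros)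
  from continuous_closed_vimage[OF essential_idealD(2)[OF J] this]
  show "closed {x. a * x \<in> J}" by (simp add: vimage_def)
  fix I :: "'a set" assume I: "right_ideal I \<and> I \<noteq> {0}"
  note rI = right_idealD[OF conjunct1[OF I]]
  show "{x. a * x \<in> J} \<inter> I \<noteq> {0}"
  proof (cases "\<forall>x\<in>I. a * x = 0")
    case True
    then have "I \<subseteq> {x. a * x \<in> J}" using ri(1) by auto
    with I show ?thesis by (simp add: Int_absorb1)
  next
    case False
    let ?aI = "(\<lambda>x. a * x) ` I"
    have "right_ideal ?aI"
      unfolding right_ideal_def complex_subspace_def
    proof (safe)
      show "0 \<in> ?aI" by (rule image_eqI[of _ _ 0]) (use rI in simp_all)
      show "a * x + a * y \<in> ?aI" if "x \<in> I" "y \<in> I" for x y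
        by (rule image_eqI[of _ _ "x + y"]) (use rI that in \<open>simp_all add: distrib_left\<close>)
      show "c *\<^sub>C (a * x) \<in> ?aI" if "x \<in> I" for c x
        by (rule image_eqI[of _ _ "c *\<^sub>C x"]) (use rI that in \<open>simp_all add: mult_scaleC_right\<close>)
      show "a * x * y \<in> ?aI" if "x \<in> I" for x y
        by (rule image_eqI[of _ _ "x * y"]) (use rI that in \<open>simp_all add: mult.assoc\<close>)
    qed
    moreover obtain y where "a * y \<in> ?aI" "a * y \<noteq> 0" using False by blast
    ultimately obtain x where "x \<in> I" "a * x \<in> J" "a * x \<noteq> 0"
      using essential_ideal_meets[OF J] by blast
    then have "x \<in> {x. a * x \<in> J} \<inter> I" "x \<noteq> 0" by auto
    then show ?thesis by blast
  qed
qed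

section \<open>The Cauchy-Schwarz inequality\<close>

lemma positive_add: "positive a \<Longrightarrow> positive b \<Longrightarrow> positive (a + b)"
  by (simp add: positive_iff_nonneg lmul_add nonneg_add)

lemma positive_norm_conjugate:
  assumes p: "positive p"
  shows "positive (norm p *\<^sub>R (a\<^sup>\<star> * a) - a\<^sup>\<star> * p * a)"
proof -
  have "nonneg (norm p *\<^sub>R 1 - lmul p)"
    by (rule nonneg_norm_minus) (use p in \<open>simp_all add: positive_star selfadjoint_lmul norm_lmul\<close>)
  from nonneg_conjugate[OF this, of "lmul a"] show ?thesis
    by (simp add: positive_iff_nonneg lmul_diff lmul_scaleR lmul_mult lmul_star algebra_simps)
qed

lemma scaleC_of_minus1: "(- 1) *\<^sub>C (x::'v::complex_vector) = - x"
  by (simp add: scaleC_minus_left scaleC_one)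

lemma complex_subspaceD:
  assumes "complex_subspace S"
  shows "0 \<in> S" "x \<in> S \<Longrightarrow> y \<in> S \<Longrightarrow> x + y \<in> S" "x \<in> S \<Longrightarrow> c *\<^sub>C x \<in> S"
    "x \<in> S \<Longrightarrow> - x \<in> S" "x \<in> S \<Longrightarrow> y \<in> S \<Longrightarrow> x - y \<in> S"
proof -
  show add: "0 \<in> S" "x \<in> S \<Longrightarrow> y \<in> S \<Longrightarrow> x + y \<in> S" "x \<in> S \<Longrightarrow> c *\<^sub>C x \<in> S" for x y c
    using assms by (auto simp: complex_subspace_def)
  show minus: "x \<in> S \<Longrightarrow> - x \<in> S" for x
    using add(3)[of x "- 1"] by (simp add: scaleC_of_minus1)
  show "x \<in> S \<Longrightarrow> y \<in> S \<Longrightarrow> x - y \<in> S"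
    using add(2)[of x "- y"] minus[of y] by simp
qed

context inner_product_cstar_module
begin

lemmas S_closed = complex_subspaceD[OF subspace]

lemma ip_add_left: "x \<in> S \<Longrightarrow> y \<in> S \<Longrightarrow> z \<in> S \<Longrightarrow> ip (x + y) z = ip x z + ip y z"
  using ip_star[of z "x + y"] ip_add_right[of z x y] ip_star[of z x] ip_star[of z y] S_closed(2)[of x y]
  by (simp add: star_add)

lemma ip_scaleC_left: "x \<in> S \<Longrightarrow> y \<in> S \<Longrightarrow> ip (c *\<^sub>C x) y = cnj c *\<^sub>C ip x y"
  using ip_star[of y "c *\<^sub>C x"] ip_scaleC_right[of y x c] ip_star[of y x] S_closed(3)[of x c]
  by (simp add: star_scaleC)

lemma ip_act_left: "x \<in> S \<Longrightarrow> y \<in> S \<Longrightarrow> ip (act x a) y = a\<^sup>\<star> * ip x y"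
  using ip_star[of y "act x a"] ip_act_right[of y x a] ip_star[of y x] act_closed[of x a]
  by (simp add: star_mult)

lemma ip_zero_right: "x \<in> S \<Longrightarrow> ip x 0 = 0"
  using ip_scaleC_right[of x x 0] by simp

lemma ip_zero_left: "x \<in> S \<Longrightarrow> ip 0 x = 0"
  using ip_scaleC_left[of x x 0] by simp

lemma ip_diff_right: "x \<in> S \<Longrightarrow> y \<in> S \<Longrightarrow> z \<in> S \<Longrightarrow> ip x (y - z) = ip x y - ip x z"
  using ip_add_right[of x "y - z" z] S_closed(5)[of y z] by simp

lemma ip_diff_left: "x \<in> S \<Longrightarrow> y \<in> S \<Longrightarrow> z \<in> S \<Longrightarrow> ip (x - y) z = ip x z - ip y z"
  using ip_add_left[of "x - y" y z] S_closed(5)[of x y] by simp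

lemma ip_norm_nonneg: "0 \<le> ip_norm ip x"
  by (simp add: ip_norm_def)

lemma ip_norm_square: "(ip_norm ip x)\<^sup>2 = norm (ip x x)"
  by (simp add: ip_norm_def)

lemma ip_norm_eq_0: "x \<in> S \<Longrightarrow> ip_norm ip x = 0 \<longleftrightarrow> x = 0"
  by (auto simp: ip_norm_def ip_definite ip_zero_right)

lemma ip_norm_scaleC: "x \<in> S \<Longrightarrow> ip_norm ip (c *\<^sub>C x) = cmod c * ip_norm ip x"
  by (simp add: ip_norm_def ip_scaleC_right ip_scaleC_left S_closed norm_scaleC real_sqrt_mult)

text \<open>
  Expand \<open>\<langle>z, z\<rangle> \<ge> 0\<close> for \<open>z = x a - r y\<close> with \<open>a = \<langle>x, y\<rangle>\<close>, and use \<open>a\<^sup>\<star> \<langle>x, x\<rangle> a \<le> r a\<^sup>\<star> a\<close>.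
\<close>

lemma cauchy_schwarz_positive:
  assumes x: "x \<in> S" and y: "y \<in> S"
  defines "r \<equiv> norm (ip x x)"
  shows "positive ((r * r) *\<^sub>R ip y y - r *\<^sub>R ((ip x y)\<^sup>\<star> * ip x y))"
proof -
  define a where "a = ip x y"
  have as: "ip y x = a\<^sup>\<star>" using ip_star[OF x y] by (simp add: a_def)
  define z where "z = act x a - complex_of_real r *\<^sub>C y"
  have mem: "act x a \<in> S" "complex_of_real r *\<^sub>C y \<in> S" "z \<in> S"
    using x y by (simp_all add: act_closed S_closed z_def)
  have zz: "ip z z = a\<^sup>\<star> * ip x x * a - r *\<^sub>R (a\<^sup>\<star> * a) - r *\<^sub>R (a\<^sup>\<star> * a) + (r * r) *\<^sub>R ip y y"
    using mem x y unfolding z_def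
    by (simp add: ip_diff_left ip_diff_right ip_act_left ip_act_right ip_scaleC_left ip_scaleC_right
        as a_def[symmetric] mult_scaleC_left mult_scaleC_right scaleC_scaleC scaleR_scaleC mult.assoc
        S_closed left_diff_distrib scaleC_diff_right)
  have "positive (ip z z + (r *\<^sub>R (a\<^sup>\<star> * a) - a\<^sup>\<star> * ip x x * a))"
    unfolding r_def by (rule positive_add[OF ip_positive[OF mem(3)] positive_norm_conjugate[OF ip_positive[OF x]]])
  then show ?thesis unfolding zz a_def[symmetric] by (simp add: algebra_simps)
qed

lemma cauchy_schwarz:
  assumes x: "x \<in> S" and y: "y \<in> S"
  shows "norm (ip x y) \<le> ip_norm ip x * ip_norm ip y"
proof (cases "x = 0")
  case True
  with y show ?thesis by (simp add: ip_zero_left ip_norm_nonneg)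
next
  case False
  define r where "r = norm (ip x x)"
  have r: "r > 0" using False ip_definite[OF x] by (auto simp: r_def)
  have "r *\<^sub>R ((ip x y)\<^sup>\<star> * ip x y) = (sqrt r *\<^sub>R ip x y)\<^sup>\<star> * (sqrt r *\<^sub>R ip x y)"
    using r by (simp add: star_scaleR)
  then have "positive (r *\<^sub>R ((ip x y)\<^sup>\<star> * ip x y))" unfolding positive_def by blast
  from norm_mono_positive[OF cauchy_schwarz_positive[OF x y, folded r_def] this]
  have "norm (r *\<^sub>R ((ip x y)\<^sup>\<star> * ip x y)) \<le> norm ((r * r) *\<^sub>R ip y y)" .
  then have "r * (norm (ip x y))\<^sup>2 \<le> r * (r * norm (ip y y))"
    using r by (simp add: cstar_identity)
  then have "(norm (ip x y))\<^sup>2 \<le> r * norm (ip y y)" using r by simp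
  also have "\<dots> = (ip_norm ip x * ip_norm ip y)\<^sup>2"
    by (simp add: power_mult_distrib ip_norm_square r_def)
  finally show ?thesis by (rule power2_le_imp_le) (simp add: ip_norm_nonneg)
qed

end

section \<open>The dual module\<close>

locale cstar_module_type = inner_product_cstar_module UNIV act ip
  for act :: "'m::complex_vector \<Rightarrow> 'a::cstar_algebra \<Rightarrow> 'm" and ip :: "'m \<Rightarrow> 'm \<Rightarrow> 'a"
begin

abbreviation "dual \<equiv> dual_module act ip"
abbreviation "dnorm \<equiv> dual_norm ip"
abbreviation "emb \<equiv> module_embed ip"

lemma dualD:
  assumes "f \<in> dual"
  shows "f (m + n) = f m + f n" "f (c *\<^sub>C m) = cnj c *\<^sub>C f m" "f (act m a) = a\<^sup>\<star> * f m"
  using assms by (auto simp: dual_module_def)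

lemma dual_norm_upper:
  assumes f: "f \<in> dual" and m: "ip_norm ip m \<le> 1"
  shows "norm (f m) \<le> dnorm f"
  unfolding dual_norm_def
proof (rule cSUP_upper)
  obtain K where K: "\<And>m. norm (f m) \<le> K * ip_norm ip m" using f by (auto simp: dual_module_def)
  show "bdd_above ((\<lambda>m. norm (f m)) ` {m. ip_norm ip m \<le> 1})"
  proof (rule bdd_aboveI2)
    fix m assume "m \<in> {m. ip_norm ip m \<le> 1}"
    then have "K * ip_norm ip m \<le> \<bar>K\<bar> * 1"
      by (intro mult_mono) (simp_all add: ip_norm_nonneg)
    with K[of m] show "norm (f m) \<le> \<bar>K\<bar>" by simp
  qed
qed (use m in simp)

lemma dual_norm_nonneg: "f \<in> dual \<Longrightarrow> 0 \<le> dnorm f"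
  using order_trans[OF norm_ge_zero dual_norm_upper, of f 0] ip_norm_eq_0[of 0] by simp

lemma dual_norm_bound:
  assumes f: "f \<in> dual"
  shows "norm (f m) \<le> dnorm f * ip_norm ip m"
proof (cases "m = 0")
  case True
  have "f 0 = 0" using dualD(2)[OF f, of 0 0] by simp
  with True show ?thesis using ip_norm_eq_0[of 0] by simp
next
  case False
  define r where "r = ip_norm ip m"
  have r: "r > 0" using False ip_norm_eq_0[of m] ip_norm_nonneg[of m] by (simp add: r_def)
  have "norm (f (complex_of_real (1/r) *\<^sub>C m)) \<le> dnorm f"
    by (rule dual_norm_upper[OF f]) (use r in \<open>simp add: ip_norm_scaleC norm_divide flip: r_def\<close>)
  then show ?thesis using r
    by (simp add: dualD(2)[OF f] norm_scaleC norm_divide field_simps flip: r_def)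
qed

lemma dual_norm_le:
  assumes "\<And>m. norm (f m) \<le> K * ip_norm ip m" "K \<ge> 0"
  shows "dnorm f \<le> K"
  unfolding dual_norm_def
proof (rule cSUP_least)
  show "{m. ip_norm ip m \<le> 1} \<noteq> {}" using ip_norm_eq_0[of 0] by (auto intro!: exI[of _ 0])
  fix m assume "m \<in> {m. ip_norm ip m \<le> 1}"
  with assms(1)[of m] mult_left_mono[of "ip_norm ip m" 1 K] assms(2) show "norm (f m) \<le> K" by simp
qed

lemma dualI:
  assumes "\<And>m n. f (m + n) = f m + f n" "\<And>c m. f (c *\<^sub>C m) = cnj c *\<^sub>C f m"
    "\<And>m a. f (act m a) = a\<^sup>\<star> * f m" "\<And>m. norm (f m) \<le> K * ip_norm ip m"
  shows "f \<in> dual"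
  using assms unfolding dual_module_def by blast

lemma dual_add:
  assumes f: "f \<in> dual" and g: "g \<in> dual"
  shows "f + g \<in> dual" "dnorm (f + g) \<le> dnorm f + dnorm g"
proof -
  have b: "norm ((f + g) m) \<le> (dnorm f + dnorm g) * ip_norm ip m" for m
    using norm_triangle_ineq[of "f m" "g m"] dual_norm_bound[OF f, of m] dual_norm_bound[OF g, of m]
    by (simp add: distrib_right)
  show "f + g \<in> dual"
    by (rule dualI[OF _ _ _ b]) (simp_all add: dualD[OF f] dualD[OF g] scaleC_add_right distrib_left)
  show "dnorm (f + g) \<le> dnorm f + dnorm g"
    by (rule dual_norm_le[OF b]) (simp add: dual_norm_nonneg f g)
qed

lemma dual_scaleC:
  assumes f: "f \<in> dual"
  shows "c *\<^sub>C f \<in> dual" "dnorm (c *\<^sub>C f) \<le> cmod c * dnorm f"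
proof -
  have b: "norm ((c *\<^sub>C f) m) \<le> (cmod c * dnorm f) * ip_norm ip m" for m
    using mult_left_mono[OF dual_norm_bound[OF f, of m], of "cmod c"]
    by (simp add: scaleC_fun_def norm_scaleC mult.assoc)
  show "c *\<^sub>C f \<in> dual"
    by (rule dualI[OF _ _ _ b])
      (simp_all add: scaleC_fun_def dualD[OF f] scaleC_simps mult.commute)
  show "dnorm (c *\<^sub>C f) \<le> cmod c * dnorm f"
    by (rule dual_norm_le[OF b]) (simp add: dual_norm_nonneg f)
qed

lemma dual_dual_act:
  assumes f: "f \<in> dual"
  shows "dual_act f a \<in> dual" "dnorm (dual_act f a) \<le> dnorm f * norm a"
proof -
  have b: "norm (dual_act f a m) \<le> (dnorm f * norm a) * ip_norm ip m" for m
    using order_trans[OF norm_mult_ineq[of "f m" a] mult_right_mono[OF dual_norm_bound[OF f, of m]]]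
    by (simp add: dual_act_def mult.assoc mult.commute[of "norm a"])
  show "dual_act f a \<in> dual"
    by (rule dualI[OF _ _ _ b])
      (simp_all add: dual_act_def dualD[OF f] mult_scaleC_left distrib_right mult.assoc)
  show "dnorm (dual_act f a) \<le> dnorm f * norm a"
    by (rule dual_norm_le[OF b]) (simp add: dual_norm_nonneg f)
qed

lemma dual_zero: "0 \<in> dual" "dnorm 0 = 0"
proof -
  show z: "0 \<in> dual" by (rule dualI[where K = 0]) simp_all
  show "dnorm 0 = 0" by (rule antisym[OF dual_norm_le dual_norm_nonneg[OF z]]) simp_all
qed

lemma dual_subspace: "complex_subspace dual"
  by (simp add: complex_subspace_def dual_zero dual_add dual_scaleC)

lemmas dual_closed = complex_subspaceD[OF dual_subspace]

lemma dual_norm_minus_commute: "f - g \<in> dual \<Longrightarrow> dnorm (f - g) = dnorm (g - f)"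
proof -
  have "norm ((f - g) m) = norm ((g - f) m)" for m by (simp add: norm_minus_commute)
  then show ?thesis unfolding dual_norm_def by (simp only:)
qed

lemma dual_norm_triangle_diff:
  assumes "f \<in> dual" "g \<in> dual" "h \<in> dual"
  shows "dnorm (f - h) \<le> dnorm (f - g) + dnorm (g - h)"
  using dual_add(2)[of "f - g" "g - h"] assms by (simp add: dual_closed)

lemma dual_norm_eq_0:
  assumes f: "f \<in> dual" and "dnorm f = 0" shows "f = 0"
  using dual_norm_bound[OF f] assms(2) by (auto simp: fun_eq_iff)

lemma emb_simps:
  "emb (m + n) = emb m + emb n" "emb (c *\<^sub>C m) = c *\<^sub>C emb m" "emb (act m a) = dual_act (emb m) a"
  by (simp_all add: module_embed_def fun_eq_iff ip_add_right ip_scaleC_right ip_act_right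
      scaleC_fun_def dual_act_def)

lemma emb_dual: "emb m \<in> dual"
proof (rule dualI)
  show "norm (emb m n) \<le> ip_norm ip m * ip_norm ip n" for n
    using cauchy_schwarz[of n m] by (simp add: module_embed_def mult.commute)
qed (simp_all add: module_embed_def ip_add_left ip_scaleC_left ip_act_left)

lemma dual_norm_emb: "dnorm (emb m) = ip_norm ip m"
proof (rule antisym)
  show "dnorm (emb m) \<le> ip_norm ip m"
    using cauchy_schwarz[of _ m] ip_norm_nonneg[of m]
    by (intro dual_norm_le) (simp_all add: module_embed_def mult.commute)
  have "ip_norm ip m * ip_norm ip m \<le> dnorm (emb m) * ip_norm ip m"
    using dual_norm_bound[OF emb_dual, of m m] ip_norm_square[of m]
    by (simp add: module_embed_def power2_eq_square)
  then show "ip_norm ip m \<le> dnorm (emb m)"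
    using ip_norm_nonneg[of m] dual_norm_nonneg[OF emb_dual, of m]
    by (cases "ip_norm ip m = 0") (auto simp: mult_le_cancel_right)
qed

lemma emb_eq_iff: "emb m = emb n \<longleftrightarrow> m = n"
proof
  assume e: "emb m = emb n"
  have "ip k (m - n) = 0" for k
    using fun_cong[OF e, of k] by (simp add: module_embed_def ip_diff_right)
  then have "m - n = 0" using ip_definite by blast
  then show "m = n" by simp
qed simp

lemma inv_emb [simp]: "inv emb (emb m) = m"
  by (rule inv_f_f) (simp add: inj_def emb_eq_iff)

lemma dual_act_simps:
  "dual_act (f + g) a = dual_act f a + dual_act g a" "dual_act f (a + b) = dual_act f a + dual_act f b"
  "dual_act f (a * b) = dual_act (dual_act f a) b" "dual_act (c *\<^sub>C f) a = c *\<^sub>C dual_act f a"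
  "dual_act f (c *\<^sub>C a) = c *\<^sub>C dual_act f a" "dual_act (f - g) a = dual_act f a - dual_act g a"
  for f g :: "'m \<Rightarrow> 'a"
  by (simp_all add: dual_act_def fun_eq_iff algebra_simps scaleC_fun_def mult_scaleC_left
      mult_scaleC_right)

lemma right_cstar_module_subspace:
  assumes "complex_subspace T" "\<And>f a. f \<in> T \<Longrightarrow> dual_act f a \<in> T"
  shows "right_cstar_module T (dual_act :: ('m \<Rightarrow> 'a) \<Rightarrow> 'a \<Rightarrow> 'm \<Rightarrow> 'a)"
  by (rule right_cstar_module.intro) (simp_all add: assms dual_act_simps)

end

section \<open>The pairing\<close>

lemma cancel_right: "(\<And>y. c * y = 0) \<Longrightarrow> (c::'a::cstar_algebra) = 0"
  by (metis cancel_left star_mult star_star star_zero)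

lemma dual_act_cancel:
  assumes J: "essential_closed_right_ideal J" and fg: "\<And>x. x \<in> J \<Longrightarrow> dual_act f x = dual_act g x"
  shows "f = g"
proof
  fix m
  have "(f m - g m) * x = 0" if "x \<in> J" for x
    using fun_cong[OF fg[OF that], of m] by (simp add: dual_act_def algebra_simps)
  from essential_ideal_cancel[OF J this] show "f m = g m" by simp
qed

context cstar_module_type
begin

abbreviation "M\<^sub>1 \<equiv> M1 act ip"
abbreviation "M\<^sub>0 \<equiv> M0 act ip"

lemma maps_into_module_iff:
  "maps_into_module ip f J \<longleftrightarrow> (\<forall>x\<in>J. \<exists>m. dual_act f x = emb m)"
  by (auto simp: maps_into_module_def)

lemma M1_dual: "f \<in> M\<^sub>1 \<Longrightarrow> f \<in> dual"
  by (simp add: M1_def)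

lemma M1_ideal:
  "f \<in> M\<^sub>1 \<Longrightarrow> \<exists>J. essential_closed_right_ideal J \<and> (\<forall>x\<in>J. \<exists>m. dual_act f x = emb m)"
  by (auto simp: M1_def maps_into_module_iff)

lemma M1_I:
  assumes "f \<in> dual" "essential_closed_right_ideal J" "\<And>x. x \<in> J \<Longrightarrow> \<exists>m. dual_act f x = emb m"
  shows "f \<in> M\<^sub>1"
  using assms by (auto simp: M1_def maps_into_module_iff)

lemma M1_add:
  assumes f: "f \<in> M\<^sub>1" and g: "g \<in> M\<^sub>1" shows "f + g \<in> M\<^sub>1"
proof -
  from M1_ideal[OF f] obtain J where J: "essential_closed_right_ideal J" "\<And>x. x \<in> J \<Longrightarrow> \<exists>m. dual_act f x = emb m"
    by blast
  from M1_ideal[OF g] obtain K where K: "essential_closed_right_ideal K" "\<And>x. x \<in> K \<Longrightarrow> \<exists>m. dual_act g x = emb m"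
    by blast
  show ?thesis
  proof (rule M1_I[OF _ essential_ideal_Int[OF J(1) K(1)]])
    fix x assume "x \<in> J \<inter> K"
    then obtain m n where "dual_act f x = emb m" "dual_act g x = emb n" using J(2) K(2) by blast
    then have "dual_act (f + g) x = emb (m + n)" by (simp add: dual_act_simps emb_simps)
    then show "\<exists>m. dual_act (f + g) x = emb m" ..
  qed (simp add: f g dual_closed M1_dual)
qed

lemma M1_scaleC:
  assumes f: "f \<in> M\<^sub>1" shows "c *\<^sub>C f \<in> M\<^sub>1"
proof -
  from M1_ideal[OF f] obtain J where J: "essential_closed_right_ideal J" "\<And>x. x \<in> J \<Longrightarrow> \<exists>m. dual_act f x = emb m"
    by blast
  show ?thesis
  proof (rule M1_I[OF _ J(1)])
    fix x assume "x \<in> J"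
    then obtain m where "dual_act f x = emb m" using J(2) by blast
    then have "dual_act (c *\<^sub>C f) x = emb (c *\<^sub>C m)" by (simp add: dual_act_simps emb_simps)
    then show "\<exists>m. dual_act (c *\<^sub>C f) x = emb m" ..
  qed (simp add: f dual_closed M1_dual)
qed

lemma M1_act:
  assumes f: "f \<in> M\<^sub>1" shows "dual_act f a \<in> M\<^sub>1"
proof -
  from M1_ideal[OF f] obtain J where J: "essential_closed_right_ideal J" "\<And>x. x \<in> J \<Longrightarrow> \<exists>m. dual_act f x = emb m"
    by blast
  show ?thesis
  proof (rule M1_I[OF _ essential_ideal_preimage[OF J(1), of a]])
    fix x assume "x \<in> {x. a * x \<in> J}"
    then show "\<exists>m. dual_act (dual_act f a) x = emb m" using J(2)[of "a * x"] by (simp add: dual_act_simps)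
  qed (simp add: f dual_dual_act M1_dual)
qed

lemma emb_M1: "emb m \<in> M\<^sub>1"
  by (rule M1_I[OF emb_dual essential_ideal_UNIV]) (auto simp flip: emb_simps)

text \<open>
  The ideal-free form of \<open>\<langle>g, f\<rangle> = a\<close>.  For \<open>m = g x\<close> the pairing of \<open>x\<close> and \<open>y\<close> is \<open>f m y\<close>, so the representing
  condition \<open>f m y = x\<^sup>\<star> a y\<close> for all \<open>y\<close> amounts to \<open>f m = x\<^sup>\<star> a\<close>; here \<open>x\<close> ranges over all elements with \<open>g x\<close>
  in \<open>M\<close>.
\<close>

definition pairs :: "('m \<Rightarrow> 'a) \<Rightarrow> ('m \<Rightarrow> 'a) \<Rightarrow> 'a \<Rightarrow> bool" where
  "pairs f g a \<longleftrightarrow> (\<forall>x m. dual_act g x = emb m \<longrightarrow> f m = x\<^sup>\<star> * a)"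

lemma pairsD: "pairs f g a \<Longrightarrow> dual_act g x = emb m \<Longrightarrow> f m = x\<^sup>\<star> * a"
  by (simp add: pairs_def)

text \<open>
  For the step from \<open>J\<close> to an arbitrary \<open>x\<close> with \<open>g x = m\<close> in \<open>M\<close>: if \<open>x z \<in> J\<close>, the condition at \<open>x z\<close> reads
  \<open>z\<^sup>\<star> f m = z\<^sup>\<star> x\<^sup>\<star> a\<close>, and the elements \<open>z\<close> with \<open>x z \<in> J\<close> form an essential ideal, so \<open>z\<^sup>\<star>\<close> cancels.
\<close>

lemma represents_iff_pairs:
  assumes f: "f \<in> M\<^sub>1" and g: "g \<in> M\<^sub>1"
  shows "represents ip f g a \<longleftrightarrow> pairs f g a"
proof
  assume "pairs f g a"
  from M1_ideal[OF f] obtain J where J: "essential_closed_right_ideal J" "\<And>x. x \<in> J \<Longrightarrow> \<exists>m. dual_act f x = emb m"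
    by blast
  from M1_ideal[OF g] obtain K where K: "essential_closed_right_ideal K" "\<And>x. x \<in> K \<Longrightarrow> \<exists>m. dual_act g x = emb m"
    by blast
  have "pairing ip f g x y = iota a x y" if "x \<in> J \<inter> K" for x y
  proof -
    from that K(2) obtain m where m: "dual_act g x = emb m" by blast
    then show ?thesis
      using pairsD[OF \<open>pairs f g a\<close> m] by (simp add: pairing_def iota_def dual_act_def[of f])
  qed
  then show "represents ip f g a"
    unfolding represents_def maps_into_module_iff
    using essential_ideal_Int[OF J(1) K(1)] J(2) K(2) by blast
next
  assume "represents ip f g a"
  then obtain J where J: "essential_closed_right_ideal J" "\<And>x. x \<in> J \<Longrightarrow> \<exists>m. dual_act g x = emb m"
    and B: "\<And>x y. x \<in> J \<Longrightarrow> pairing ip f g x y = iota a x y"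
    unfolding represents_def maps_into_module_iff by blast
  have onJ: "f m = x\<^sup>\<star> * a" if "x \<in> J" "dual_act g x = emb m" for x m
  proof -
    have "(f m - x\<^sup>\<star> * a) * y = 0" for y
      using B[OF that(1), of y] by (simp add: pairing_def that(2) iota_def dual_act_def[of f] left_diff_distrib)
    from cancel_right[OF this] show ?thesis by simp
  qed
  show "pairs f g a"
    unfolding pairs_def
  proof (intro allI impI)
    fix x m assume m: "dual_act g x = emb m"
    have "z\<^sup>\<star> * (f m - x\<^sup>\<star> * a) = 0" if "z \<in> {z. x * z \<in> J}" for z
    proof -
      have "dual_act g (x * z) = emb (act m z)" by (simp add: dual_act_simps emb_simps m)
      with that have "f (act m z) = (x * z)\<^sup>\<star> * a" by (intro onJ) simp_all
      then show ?thesis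
        by (simp add: dualD(3)[OF M1_dual[OF f]] star_mult mult.assoc right_diff_distrib)
    qed
    from essential_ideal_cancel_star[OF essential_ideal_preimage[OF J(1)] this]
    show "f m = x\<^sup>\<star> * a" by simp
  qed
qed

lemma pairs_unique:
  assumes g: "g \<in> M\<^sub>1" and "pairs f g a" "pairs f g b"
  shows "a = b"
proof -
  from M1_ideal[OF g] obtain J where J: "essential_closed_right_ideal J" "\<And>x. x \<in> J \<Longrightarrow> \<exists>m. dual_act g x = emb m"
    by blast
  have "x\<^sup>\<star> * (a - b) = 0" if x: "x \<in> J" for x
  proof -
    from J(2)[OF x] obtain m where m: "dual_act g x = emb m" ..
    show ?thesis
      using pairsD[OF assms(2) m] pairsD[OF assms(3) m] by (simp add: right_diff_distrib)
  qed
  from essential_ideal_cancel_star[OF J(1) this] show ?thesis by simp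
qed

text \<open>
  For \<open>g x = m\<close> and \<open>f y = n\<close> in \<open>M\<close>, the element \<open>\<langle>m, n\<rangle>\<close> of \<open>A\<close> is \<open>f m y = x\<^sup>\<star> a y\<close>, and its adjoint is \<open>g n x\<close>.
  As \<open>x\<close> runs through an essential ideal it cancels.
\<close>

lemma pairs_star:
  assumes f: "f \<in> M\<^sub>1" and g: "g \<in> M\<^sub>1" and p: "pairs f g a"
  shows "pairs g f (a\<^sup>\<star>)"
  unfolding pairs_def
proof (intro allI impI)
  fix y n assume n: "dual_act f y = emb n"
  from M1_ideal[OF g] obtain J where J: "essential_closed_right_ideal J" "\<And>x. x \<in> J \<Longrightarrow> \<exists>m. dual_act g x = emb m"
    by blast
  have "(g n - y\<^sup>\<star> * a\<^sup>\<star>) * x = 0" if x: "x \<in> J" for x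
  proof -
    from J(2)[OF x] obtain m where m: "dual_act g x = emb m" ..
    have "g n * x = ip n m" using fun_cong[OF m, of n] by (simp add: dual_act_def module_embed_def)
    also have "\<dots> = (ip m n)\<^sup>\<star>" by (simp add: ip_star)
    also have "ip m n = f m * y" using fun_cong[OF n, of m] by (simp add: dual_act_def module_embed_def)
    also have "f m = x\<^sup>\<star> * a" by (rule pairsD[OF p m])
    finally show ?thesis by (simp add: star_mult star_star mult.assoc left_diff_distrib)
  qed
  from essential_ideal_cancel[OF J(1) this] show "g n = y\<^sup>\<star> * a\<^sup>\<star>" by simp
qed

lemma pairs_add: "pairs f g a \<Longrightarrow> pairs f' g b \<Longrightarrow> pairs (f + f') g (a + b)"
  by (simp add: pairs_def distrib_left)

lemma pairs_scaleC: "pairs f g a \<Longrightarrow> pairs (c *\<^sub>C f) g (c *\<^sub>C a)"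
  by (simp add: pairs_def scaleC_fun_def mult_scaleC_right)

lemma pairs_act: "pairs f g a \<Longrightarrow> pairs (dual_act f b) g (a * b)"
  by (simp add: pairs_def dual_act_def[of f] mult.assoc)

lemma pairs_emb_right:
  assumes f: "f \<in> dual" shows "pairs f (emb m) (f m)"
  unfolding pairs_def
proof (intro allI impI)
  fix x n assume "dual_act (emb m) x = emb n"
  then have "n = act m x" by (simp add: emb_eq_iff flip: emb_simps)
  then show "f n = x\<^sup>\<star> * f m" by (simp add: dualD(3)[OF f])
qed

lemma M0_iff: "f \<in> M\<^sub>0 \<longleftrightarrow> f \<in> M\<^sub>1 \<and> (\<forall>g\<in>M\<^sub>1. \<exists>a. pairs f g a)"
  unfolding M0_def using represents_iff_pairs by blast

lemma M0_M1: "f \<in> M\<^sub>0 \<Longrightarrow> f \<in> M\<^sub>1" by (simp add: M0_iff)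

lemma M0_dual: "f \<in> M\<^sub>0 \<Longrightarrow> f \<in> dual" by (simp add: M0_iff M1_dual)

lemma ip0_eq:
  assumes "f \<in> M\<^sub>1" "g \<in> M\<^sub>1" "pairs f g a" shows "ip0 ip g f = a"
  unfolding ip0_def represents_iff_pairs[OF assms(1,2)]
  by (rule the_equality[of "pairs f g", OF assms(3)]) (rule pairs_unique[OF assms(2) _ assms(3)])

lemma pairs_ip0: "f \<in> M\<^sub>0 \<Longrightarrow> g \<in> M\<^sub>1 \<Longrightarrow> pairs f g (ip0 ip g f)"
  using ip0_eq by (auto simp: M0_iff)

lemma M0_subspace: "complex_subspace M\<^sub>0"
proof -
  have "0 \<in> M\<^sub>1" using M1_scaleC[OF emb_M1[of 0], of 0] by simp
  moreover have "pairs 0 g 0" for g by (simp add: pairs_def)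
  ultimately show ?thesis
    unfolding complex_subspace_def
    by (fastforce simp: M0_iff intro: M1_add M1_scaleC pairs_add pairs_scaleC)
qed

lemma M0_act: "f \<in> M\<^sub>0 \<Longrightarrow> dual_act f a \<in> M\<^sub>0"
  unfolding M0_iff by (blast intro: M1_act pairs_act)

text \<open>
  Every functional \<open>g\<close> pairs with \<open>m\<close>, namely \<open>\<langle>m, g\<rangle> = g m\<close>; passing to adjoints exchanges the two.
\<close>

lemma emb_M0: "emb m \<in> M\<^sub>0"
  unfolding M0_iff
proof (intro conjI ballI)
  fix g assume g: "g \<in> M\<^sub>1"
  show "\<exists>a. pairs (emb m) g a"
    using pairs_star[OF g emb_M1 pairs_emb_right[OF M1_dual[OF g]]] by blast
qed (rule emb_M1)

lemma ip0_emb_left: "f \<in> M\<^sub>0 \<Longrightarrow> ip0 ip (emb m) f = f m"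
  by (rule ip0_eq[OF M0_M1 emb_M1 pairs_emb_right[OF M0_dual]])

lemma ip0_self_on_ideal:
  assumes f: "f \<in> M\<^sub>0" and m: "dual_act f x = emb m"
  shows "ip m m = x\<^sup>\<star> * ip0 ip f f * x"
proof -
  have "ip m m = f m * x" using fun_cong[OF m, of m] by (simp add: dual_act_def module_embed_def)
  also have "f m = x\<^sup>\<star> * ip0 ip f f" by (rule pairsD[OF pairs_ip0[OF f M0_M1[OF f]] m])
  finally show ?thesis .
qed

lemma ip0_star: "f \<in> M\<^sub>0 \<Longrightarrow> g \<in> M\<^sub>0 \<Longrightarrow> (ip0 ip f g)\<^sup>\<star> = ip0 ip g f"
  by (rule ip0_eq[symmetric]) (auto intro: M0_M1 pairs_star pairs_ip0)

sublocale M0: inner_product_cstar_module "M0 act ip" dual_act "ip0 ip"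
proof (rule inner_product_cstar_module.intro[OF right_cstar_module_subspace[OF M0_subspace M0_act]])
  show "inner_product_cstar_module_axioms M\<^sub>0 dual_act (ip0 ip)"
  proof
    fix f g h and a c assume f: "f \<in> M\<^sub>0" and g: "g \<in> M\<^sub>0"
    note cl = complex_subspaceD[OF M0_subspace]
    show "ip0 ip f (c *\<^sub>C g) = c *\<^sub>C ip0 ip f g"
      by (rule ip0_eq) (auto intro: M0_M1 cl f g pairs_scaleC pairs_ip0)
    show "ip0 ip f (dual_act g a) = ip0 ip f g * a"
      by (rule ip0_eq) (auto intro: M0_M1 M0_act f g pairs_act pairs_ip0)
    show "(ip0 ip f g)\<^sup>\<star> = ip0 ip g f" by (rule ip0_star[OF f g])
    show "ip0 ip f (g + h) = ip0 ip f g + ip0 ip f h" if "h \<in> M\<^sub>0"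
      by (rule ip0_eq) (auto intro: M0_M1 cl f g that pairs_add pairs_ip0)
  next
    fix f assume f: "f \<in> M\<^sub>0"
    from M1_ideal[OF M0_M1[OF f]] obtain J where J: "essential_closed_right_ideal J"
      "\<And>x. x \<in> J \<Longrightarrow> \<exists>m. dual_act f x = emb m" by blast
    show "positive (ip0 ip f f)"
    proof (rule positive_if_positive_on_essential[OF J(1) ip0_star[OF f f]])
      fix x assume "x \<in> J"
      then obtain m where "dual_act f x = emb m" using J(2) by blast
      then show "positive (x\<^sup>\<star> * ip0 ip f f * x)"
        using ip_positive[of m] by (simp add: ip0_self_on_ideal[OF f])
    qed
    show "f = 0" if z: "ip0 ip f f = 0"
    proof (rule dual_act_cancel[OF J(1)])
      fix x assume "x \<in> J"
      then obtain m where m: "dual_act f x = emb m" using J(2) by blast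
      then have "m = 0" using ip0_self_on_ideal[OF f m] z by (simp add: ip_definite)
      then show "dual_act f x = dual_act 0 x"
        using m by (auto simp: fun_eq_iff dual_act_def module_embed_def ip_zero_right)
    qed
  qed
qed

text \<open>
  For \<open>f x = m\<close> in \<open>M\<close>, \<open>\<parallel>x\<^sup>\<star> \<langle>f, f\<rangle> x\<parallel> = \<parallel>m\<parallel>\<^sup>2 \<le> \<parallel>f\<parallel>\<^sup>2 \<parallel>x\<parallel>\<^sup>2\<close>, and such \<open>x\<close> fill an essential ideal; this bounds \<open>\<langle>f, f\<rangle>\<close>.
  Conversely \<open>f m = \<langle>m, f\<rangle>\<close>, so the Cauchy-Schwarz inequality in \<open>M\<^sub>0\<close> bounds the norm of \<open>f\<close> as a functional.
\<close>

lemma ip_norm_ip0: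
  assumes f: "f \<in> M\<^sub>0" shows "ip_norm (ip0 ip) f = dnorm f"
proof (rule antisym)
  note df = M0_dual[OF f]
  from M1_ideal[OF M0_M1[OF f]] obtain J where J: "essential_closed_right_ideal J"
    "\<And>x. x \<in> J \<Longrightarrow> \<exists>m. dual_act f x = emb m" by blast
  have "norm (ip0 ip f f) \<le> (dnorm f)\<^sup>2"
  proof (rule norm_le_if_on_essential[OF J(1) ip0_star[OF f f]])
    fix x assume "x \<in> J"
    then obtain m where m: "dual_act f x = emb m" using J(2) by blast
    have "norm (x\<^sup>\<star> * ip0 ip f f * x) = (ip_norm ip m)\<^sup>2"
      by (simp add: ip_norm_square ip0_self_on_ideal[OF f m])
    also have "ip_norm ip m \<le> dnorm f * norm x"
      using dual_dual_act(2)[OF df, of x] by (simp add: m dual_norm_emb)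
    then have "(ip_norm ip m)\<^sup>2 \<le> (dnorm f * norm x)\<^sup>2" by (rule power_mono) (rule ip_norm_nonneg)
    finally show "norm (x\<^sup>\<star> * ip0 ip f f * x) \<le> (dnorm f)\<^sup>2 * (norm x)\<^sup>2" by (simp add: power_mult_distrib)
  qed simp
  then show "ip_norm (ip0 ip) f \<le> dnorm f"
    unfolding ip_norm_def by (rule real_le_lsqrt[OF dual_norm_nonneg[OF df]])
  have "norm (f m) \<le> ip_norm (ip0 ip) f * ip_norm ip m" for m
  proof -
    have "ip_norm (ip0 ip) (emb m) = ip_norm ip m"
      by (simp add: ip_norm_def ip0_emb_left emb_M0) (simp add: module_embed_def)
    then show ?thesis
      using M0.cauchy_schwarz[OF emb_M0[of m] f] by (simp add: ip0_emb_left f mult.commute)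
  qed
  then show "dnorm f \<le> ip_norm (ip0 ip) f" by (rule dual_norm_le) (rule M0.ip_norm_nonneg)
qed

end

section \<open>The completion\<close>

lemma tendsto_scaleC:
  fixes X :: "'b \<Rightarrow> 'a::cstar_algebra"
  assumes "(X \<longlongrightarrow> x) F" shows "((\<lambda>n. c *\<^sub>C X n) \<longlongrightarrow> c *\<^sub>C x) F"
proof -
  have "bounded_linear (\<lambda>x::'a. c *\<^sub>C x)"
    by (rule bounded_linear_intro[where K = "cmod c"])
      (simp_all add: scaleR_scaleC scaleC_simps norm_scaleC mult.commute)
  from bounded_linear.tendsto[OF this assms] show ?thesis .
qed

context cstar_module_type
begin

abbreviation "M\<^sub>t \<equiv> M_tilde act ip"
abbreviation "ip\<^sub>t \<equiv> ip_tilde act ip"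

text \<open>
  Membership in \<open>M\<^sub>0\<close> is included because the inner product on the closure is a limit along sequences in \<open>M\<^sub>0\<close> only.
\<close>

definition M0_tendsto :: "(nat \<Rightarrow> 'm \<Rightarrow> 'a) \<Rightarrow> ('m \<Rightarrow> 'a) \<Rightarrow> bool" where
  "M0_tendsto F f \<longleftrightarrow> (\<forall>n. F n \<in> M\<^sub>0) \<and> (\<lambda>n. dnorm (F n - f)) \<longlonglongrightarrow> 0"

lemma M_tilde_dual: "f \<in> M\<^sub>t \<Longrightarrow> f \<in> dual"
  by (simp add: M_tilde_def)

lemma M0_subset_M_tilde: "f \<in> M\<^sub>0 \<Longrightarrow> f \<in> M\<^sub>t"
  by (auto simp: M_tilde_def M0_dual dual_zero intro!: bexI[of _ f])

lemma M0_tendsto_const: "f \<in> M\<^sub>0 \<Longrightarrow> M0_tendsto (\<lambda>n. f) f"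
  by (simp add: M0_tendsto_def dual_zero)

lemma M_tilde_approx:
  assumes f: "f \<in> M\<^sub>t" shows "\<exists>F. M0_tendsto F f"
proof -
  have "\<forall>n. \<exists>g. g \<in> M\<^sub>0 \<and> dnorm (f - g) < inverse (real (Suc n))"
    using f unfolding M_tilde_def by (simp add: Bex_def)
  then obtain F where F: "\<And>n. F n \<in> M\<^sub>0" "\<And>n. dnorm (f - F n) < inverse (real (Suc n))"
    by metis
  have d: "F n - f \<in> dual" for n using F(1)[of n] f by (simp add: dual_closed M0_dual M_tilde_dual)
  have "(\<lambda>n. dnorm (F n - f)) \<longlonglongrightarrow> 0"
  proof (rule tendsto_sandwich[OF _ _ tendsto_const LIMSEQ_inverse_real_of_nat])
    show "\<forall>\<^sub>F n in sequentially. dnorm (F n - f) \<le> inverse (real (Suc n))"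
      using F(2) by (auto intro!: always_eventually less_imp_le simp: dual_norm_minus_commute[OF d])
  qed (simp add: dual_norm_nonneg d)
  with F(1) show ?thesis by (auto simp: M0_tendsto_def)
qed

lemma M_tilde_I:
  assumes f: "f \<in> dual" and F: "M0_tendsto F f" shows "f \<in> M\<^sub>t"
  unfolding M_tilde_def
proof (safe)
  fix e :: real assume "e > 0"
  have d: "F n - f \<in> dual" for n
    using F f by (simp add: dual_closed M0_dual M0_tendsto_def)
  from F have "(\<lambda>n. dnorm (F n - f)) \<longlonglongrightarrow> 0" by (simp add: M0_tendsto_def)
  from LIMSEQ_D[OF this \<open>e > 0\<close>] obtain n where "dnorm (F n - f) < e"
    using dual_norm_nonneg[OF d] by auto
  then show "\<exists>g\<in>M\<^sub>0. dnorm (f - g) < e"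
    using F dual_norm_minus_commute[OF d[of n]] by (auto simp: M0_tendsto_def)
qed (rule f)

lemma M0_tendsto_add:
  assumes F: "M0_tendsto F f" "f \<in> dual" and G: "M0_tendsto G g" "g \<in> dual"
  shows "M0_tendsto (\<lambda>n. F n + G n) (f + g)"
proof -
  have m: "F n \<in> M\<^sub>0" "G n \<in> M\<^sub>0" for n using F G by (simp_all add: M0_tendsto_def)
  have d: "F n - f \<in> dual" "G n - g \<in> dual" "F n + G n - (f + g) \<in> dual" for n
    using m F G by (simp_all add: dual_closed M0_dual)
  have "(\<lambda>n. dnorm (F n - f) + dnorm (G n - g)) \<longlonglongrightarrow> 0 + 0"
    using F G by (intro tendsto_add) (simp_all add: M0_tendsto_def)
  then have lim: "(\<lambda>n. dnorm (F n - f) + dnorm (G n - g)) \<longlonglongrightarrow> 0" by simp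
  have "(\<lambda>n. dnorm (F n + G n - (f + g))) \<longlonglongrightarrow> 0"
  proof (rule tendsto_sandwich[OF _ _ tendsto_const lim])
    have "dnorm (F n + G n - (f + g)) \<le> dnorm (F n - f) + dnorm (G n - g)" for n
      using dual_add(2)[OF d(1)[of n] d(2)[of n]] by (simp add: algebra_simps)
    then show "\<forall>\<^sub>F n in sequentially. dnorm (F n + G n - (f + g)) \<le> dnorm (F n - f) + dnorm (G n - g)"
      by simp
  qed (simp add: dual_norm_nonneg d)
  then show ?thesis using m by (simp add: M0_tendsto_def complex_subspaceD[OF M0_subspace])
qed

lemma M0_tendsto_bounded_map:
  assumes F: "M0_tendsto F f" "f \<in> dual"
    and T: "\<And>f. f \<in> dual \<Longrightarrow> dnorm (T f) \<le> K * dnorm f" "\<And>f. f \<in> dual \<Longrightarrow> T f \<in> dual"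
      "\<And>f g. T (f - g) = T f - T g" "\<And>f. f \<in> M\<^sub>0 \<Longrightarrow> T f \<in> M\<^sub>0"
  shows "M0_tendsto (\<lambda>n. T (F n)) (T f)"
proof -
  have m: "F n \<in> M\<^sub>0" for n using F by (simp add: M0_tendsto_def)
  have d: "F n - f \<in> dual" for n using m F by (simp add: dual_closed M0_dual)
  have "(\<lambda>n. K * dnorm (F n - f)) \<longlonglongrightarrow> K * 0"
    using F by (intro tendsto_mult tendsto_const) (simp add: M0_tendsto_def)
  then have lim: "(\<lambda>n. K * dnorm (F n - f)) \<longlonglongrightarrow> 0" by simp
  have "(\<lambda>n. dnorm (T (F n) - T f)) \<longlonglongrightarrow> 0"
    by (rule tendsto_sandwich[OF _ _ tendsto_const lim])
      (use T(1,2)[OF d] dual_norm_nonneg in \<open>simp_all add: T(3)\<close>)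
  then show ?thesis using m T(4) by (simp add: M0_tendsto_def)
qed

lemma M0_tendsto_scaleC:
  assumes "M0_tendsto F f" "f \<in> dual" shows "M0_tendsto (\<lambda>n. c *\<^sub>C F n) (c *\<^sub>C f)"
  by (rule M0_tendsto_bounded_map[where T = "\<lambda>f. c *\<^sub>C f", OF assms])
    (auto intro: dual_scaleC complex_subspaceD[OF M0_subspace] simp: scaleC_diff_right)

lemma M0_tendsto_act:
  assumes "M0_tendsto F f" "f \<in> dual" shows "M0_tendsto (\<lambda>n. dual_act (F n) a) (dual_act f a)"
  by (rule M0_tendsto_bounded_map[where T = "\<lambda>f. dual_act f a" and K = "norm a", OF assms])
    (auto intro: M0_act dual_dual_act simp: dual_act_simps mult.commute[of "norm a"])

lemma M_tilde_subspace: "complex_subspace M\<^sub>t"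
proof -
  have "0 \<in> M\<^sub>t" by (rule M0_subset_M_tilde) (rule complex_subspaceD[OF M0_subspace])
  moreover have "f + g \<in> M\<^sub>t" if f: "f \<in> M\<^sub>t" and g: "g \<in> M\<^sub>t" for f g
  proof -
    from M_tilde_approx[OF f] M_tilde_approx[OF g] obtain F G where "M0_tendsto F f" "M0_tendsto G g"
      by blast
    from M0_tendsto_add[OF this(1) M_tilde_dual[OF f] this(2) M_tilde_dual[OF g]] show ?thesis
      by (rule M_tilde_I[rotated]) (simp add: dual_closed M_tilde_dual f g)
  qed
  moreover have "c *\<^sub>C f \<in> M\<^sub>t" if f: "f \<in> M\<^sub>t" for f c
  proof -
    from M_tilde_approx[OF f] obtain F where "M0_tendsto F f" by blast
    from M0_tendsto_scaleC[OF this M_tilde_dual[OF f]] show ?thesis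
      by (rule M_tilde_I[rotated]) (simp add: dual_closed M_tilde_dual f)
  qed
  ultimately show ?thesis by (simp add: complex_subspace_def)
qed

lemmas M_tilde_closed = complex_subspaceD[OF M_tilde_subspace]

lemma M_tilde_act: "f \<in> M\<^sub>t \<Longrightarrow> dual_act f a \<in> M\<^sub>t"
proof -
  assume f: "f \<in> M\<^sub>t"
  from M_tilde_approx[OF f] obtain F where "M0_tendsto F f" by blast
  from M0_tendsto_act[OF this M_tilde_dual[OF f]] show ?thesis
    by (rule M_tilde_I[rotated]) (simp add: dual_dual_act M_tilde_dual f)
qed

lemma dual_norm_tendsto:
  assumes F: "M0_tendsto F f" "f \<in> dual" shows "(\<lambda>n. dnorm (F n)) \<longlonglongrightarrow> dnorm f"
proof (rule LIM_zero_cancel, rule tendsto_rabs_zero_cancel)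
  have m: "F n \<in> dual" for n using F by (simp add: M0_tendsto_def M0_dual)
  have d: "F n - f \<in> dual" "f - F n \<in> dual" for n using m F by (simp_all add: dual_closed)
  have b: "\<bar>dnorm (F n) - dnorm f\<bar> \<le> dnorm (F n - f)" for n
    using dual_add(2)[OF d(1)[of n] F(2)] dual_add(2)[OF d(2)[of n] m[of n]]
      dual_norm_minus_commute[OF d(1)[of n]] by simp
  show "(\<lambda>n. \<bar>dnorm (F n) - dnorm f\<bar>) \<longlonglongrightarrow> 0"
  proof (rule tendsto_sandwich[OF _ _ tendsto_const])
    show "(\<lambda>n. dnorm (F n - f)) \<longlonglongrightarrow> 0" using F by (simp add: M0_tendsto_def)
  qed (simp_all add: b)
qed

lemma ip0_perturbation:
  assumes "g \<in> M\<^sub>0" "g' \<in> M\<^sub>0" "f \<in> M\<^sub>0" "f' \<in> M\<^sub>0"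
  shows "norm (ip0 ip g f - ip0 ip g' f') \<le> dnorm (g - g') * dnorm f + dnorm g' * dnorm (f - f')"
proof -
  have d: "g - g' \<in> M\<^sub>0" "f - f' \<in> M\<^sub>0" using assms by (simp_all add: complex_subspaceD[OF M0_subspace])
  have "ip0 ip g f - ip0 ip g' f' = ip0 ip (g - g') f + ip0 ip g' (f - f')"
    using assms by (simp add: M0.ip_diff_left M0.ip_diff_right)
  then have "norm (ip0 ip g f - ip0 ip g' f') \<le> norm (ip0 ip (g - g') f) + norm (ip0 ip g' (f - f'))"
    by (simp add: norm_triangle_ineq)
  also have "\<dots> \<le> dnorm (g - g') * dnorm f + dnorm g' * dnorm (f - f')"
    using M0.cauchy_schwarz[OF d(1) assms(3)] M0.cauchy_schwarz[OF assms(2) d(2)] assms d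
    by (simp add: ip_norm_ip0)
  finally show ?thesis .
qed

text \<open>
  One estimate with two independent indices serves twice: with equal sequences it shows that \<open>\<langle>G n, F n\<rangle>\<close> is Cauchy,
  with different ones that the limit does not depend on the approximation.
\<close>

lemma ip0_asymptotically_equal:
  assumes G: "M0_tendsto G g" and F: "M0_tendsto F f"
    and G': "M0_tendsto G' g" and F': "M0_tendsto F' f"
    and g: "g \<in> dual" and f: "f \<in> dual"
  shows "\<exists>c d. c \<longlonglongrightarrow> 0 \<and> d \<longlonglongrightarrow> 0 \<and>
    (\<forall>k n. norm (ip0 ip (G k) (F k) - ip0 ip (G' n) (F' n)) \<le> c k + d n)"
proof -
  have m: "G n \<in> M\<^sub>0" "F n \<in> M\<^sub>0" "G' n \<in> M\<^sub>0" "F' n \<in> M\<^sub>0" for n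
    using F G F' G' by (simp_all add: M0_tendsto_def)
  note md = m[THEN M0_dual]
  obtain K where K: "\<And>n. \<bar>dnorm (G' n)\<bar> \<le> K" "K > 0"
    using convergent_imp_Bseq[of "\<lambda>n. dnorm (G' n)"] dual_norm_tendsto[OF G' g]
    unfolding Bseq_def convergent_def by auto
  obtain L where L: "\<And>n. \<bar>dnorm (F n)\<bar> \<le> L" "L > 0"
    using convergent_imp_Bseq[of "\<lambda>n. dnorm (F n)"] dual_norm_tendsto[OF F f]
    unfolding Bseq_def convergent_def by auto
  define c where "c n = L * dnorm (G n - g) + K * dnorm (F n - f)" for n
  define d where "d n = L * dnorm (G' n - g) + K * dnorm (F' n - f)" for n
  have "(\<lambda>n. L * dnorm (H n - g) + K * dnorm (E n - f)) \<longlonglongrightarrow> 0"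
    if "M0_tendsto H g" "M0_tendsto E f" for H E
    using that tendsto_add[OF tendsto_mult_left tendsto_mult_left, of "\<lambda>n. dnorm (H n - g)" 0 sequentially
        "\<lambda>n. dnorm (E n - f)" 0 L K]
    by (simp add: M0_tendsto_def)
  then have cd: "c \<longlonglongrightarrow> 0" "d \<longlonglongrightarrow> 0"
    unfolding c_def d_def using F G F' G' by blast+
  have "norm (ip0 ip (G k) (F k) - ip0 ip (G' n) (F' n)) \<le> c k + d n" for k n
  proof -
    have tg: "dnorm (G k - G' n) \<le> dnorm (G k - g) + dnorm (G' n - g)"
      using dual_norm_triangle_diff[OF md(1)[of k] g md(3)[of n]]
        dual_norm_minus_commute[of g "G' n"] md g by (simp add: dual_closed)
    have tf: "dnorm (F k - F' n) \<le> dnorm (F k - f) + dnorm (F' n - f)"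
      using dual_norm_triangle_diff[OF md(2)[of k] f md(4)[of n]]
        dual_norm_minus_commute[of f "F' n"] md f by (simp add: dual_closed)
    have "dnorm (G k - G' n) * dnorm (F k) \<le> (dnorm (G k - g) + dnorm (G' n - g)) * L"
      using L(1)[of k] by (intro mult_mono tg) (auto simp: dual_norm_nonneg md g dual_closed)
    moreover have "dnorm (G' n) * dnorm (F k - F' n) \<le> K * (dnorm (F k - f) + dnorm (F' n - f))"
      using K(1)[of n] K(2) by (intro mult_mono tf) (auto simp: dual_norm_nonneg md f dual_closed)
    ultimately show ?thesis
      using ip0_perturbation[OF m(1)[of k] m(3)[of n] m(2)[of k] m(4)[of n]]
      by (simp add: c_def d_def algebra_simps)
  qed
  with cd show ?thesis by blast
qed

lemma ip0_convergent:
  assumes G: "M0_tendsto G g" and F: "M0_tendsto F f" and g: "g \<in> dual" and f: "f \<in> dual"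
  shows "convergent (\<lambda>n. ip0 ip (G n) (F n))"
proof -
  from ip0_asymptotically_equal[OF G F G F g f] obtain c d where c: "c \<longlonglongrightarrow> 0" and d: "d \<longlonglongrightarrow> 0"
    and b: "\<And>k n. norm (ip0 ip (G k) (F k) - ip0 ip (G n) (F n)) \<le> c k + d n" by blast
  have "Cauchy (\<lambda>n. ip0 ip (G n) (F n))"
  proof (rule CauchyI)
    fix e :: real assume e: "e > 0"
    from LIMSEQ_D[OF c, of "e/2"] e obtain N where N: "\<And>n. n \<ge> N \<Longrightarrow> \<bar>c n\<bar> < e/2" by auto
    from LIMSEQ_D[OF d, of "e/2"] e obtain N' where N': "\<And>n. n \<ge> N' \<Longrightarrow> \<bar>d n\<bar> < e/2" by auto
    have "norm (ip0 ip (G k) (F k) - ip0 ip (G n) (F n)) < e" if "k \<ge> max N N'" "n \<ge> max N N'" for k n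
      using b[of k n] N[of k] N'[of n] that by (simp add: abs_less_iff)
    then show "\<exists>N. \<forall>k\<ge>N. \<forall>n\<ge>N. norm (ip0 ip (G k) (F k) - ip0 ip (G n) (F n)) < e" by blast
  qed
  then show ?thesis by (simp add: Cauchy_convergent_iff)
qed

lemma ip_tilde_tendsto:
  assumes G: "M0_tendsto G g" and F: "M0_tendsto F f" and g: "g \<in> dual" and f: "f \<in> dual"
  shows "(\<lambda>n. ip0 ip (G n) (F n)) \<longlonglongrightarrow> ip\<^sub>t g f"
proof -
  let ?P = "\<lambda>a. \<forall>G F. (\<forall>n. G n \<in> M\<^sub>0) \<and> (\<forall>n. F n \<in> M\<^sub>0) \<and>
        (\<lambda>n. dnorm (G n - g)) \<longlonglongrightarrow> 0 \<and> (\<lambda>n. dnorm (F n - f)) \<longlonglongrightarrow> 0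
        \<longrightarrow> (\<lambda>n. ip0 ip (G n) (F n)) \<longlonglongrightarrow> a"
  from ip0_convergent[OF G F g f] obtain a where a: "(\<lambda>n. ip0 ip (G n) (F n)) \<longlonglongrightarrow> a"
    by (auto simp: convergent_def)
  have lim: "(\<lambda>n. ip0 ip (G' n) (F' n)) \<longlonglongrightarrow> a" if G': "M0_tendsto G' g" and F': "M0_tendsto F' f" for G' F'
  proof (rule Lim_transform[OF a])
    from ip0_asymptotically_equal[OF G' F' G F g f] obtain c d where "c \<longlonglongrightarrow> 0" "d \<longlonglongrightarrow> 0"
      and b: "\<And>k n. norm (ip0 ip (G' k) (F' k) - ip0 ip (G n) (F n)) \<le> c k + d n" by blast
    then have "(\<lambda>n. c n + d n) \<longlonglongrightarrow> 0" using tendsto_add[of c 0 sequentially d 0] by simp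
    then show "(\<lambda>n. ip0 ip (G' n) (F' n) - ip0 ip (G n) (F n)) \<longlonglongrightarrow> 0"
      by (rule Lim_null_comparison[rotated]) (simp add: b)
  qed
  have Pa: "?P a"
  proof (intro allI impI)
    fix G' F'
    assume "(\<forall>n. G' n \<in> M\<^sub>0) \<and> (\<forall>n. F' n \<in> M\<^sub>0) \<and>
        (\<lambda>n. dnorm (G' n - g)) \<longlonglongrightarrow> 0 \<and> (\<lambda>n. dnorm (F' n - f)) \<longlonglongrightarrow> 0"
    then show "(\<lambda>n. ip0 ip (G' n) (F' n)) \<longlonglongrightarrow> a"
      by (intro lim) (simp_all add: M0_tendsto_def)
  qed
  have "b = a" if "?P b" for b
  proof -
    have "(\<lambda>n. ip0 ip (G n) (F n)) \<longlonglongrightarrow> b"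
      using that G F by (simp add: M0_tendsto_def)
    from LIMSEQ_unique[OF this a] show ?thesis .
  qed
  with Pa have "ip\<^sub>t g f = a" unfolding ip_tilde_def by (rule the_equality)
  with a show ?thesis by simp
qed

lemma ip_tilde_M0:
  assumes "g \<in> M\<^sub>0" "f \<in> M\<^sub>0" shows "ip\<^sub>t g f = ip0 ip g f"
  using ip_tilde_tendsto[OF M0_tendsto_const M0_tendsto_const] assms
  by (intro LIMSEQ_unique[OF _ tendsto_const]) (simp_all add: M0_dual)

lemma ip_norm_ip_tilde:
  assumes f: "f \<in> M\<^sub>t" shows "ip_norm ip\<^sub>t f = dnorm f"
proof -
  note df = M_tilde_dual[OF f]
  from M_tilde_approx[OF f] obtain F where F: "M0_tendsto F f" by blast
  have "(\<lambda>n. ip_norm (ip0 ip) (F n)) \<longlonglongrightarrow> ip_norm ip\<^sub>t f"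
    unfolding ip_norm_def by (intro tendsto_real_sqrt tendsto_norm ip_tilde_tendsto F df)
  moreover have "ip_norm (ip0 ip) (F n) = dnorm (F n)" for n
    using F by (simp add: ip_norm_ip0 M0_tendsto_def)
  ultimately show ?thesis using LIMSEQ_unique[OF _ dual_norm_tendsto[OF F df]] by simp
qed

lemma M_tilde_inner_product: "inner_product_cstar_module M\<^sub>t dual_act ip\<^sub>t"
proof (rule inner_product_cstar_module.intro[OF right_cstar_module_subspace[OF M_tilde_subspace M_tilde_act]])
  note cl = complex_subspaceD[OF M0_subspace]
  show "inner_product_cstar_module_axioms M\<^sub>t dual_act ip\<^sub>t"
  proof
    fix f g h and a c assume f: "f \<in> M\<^sub>t" and g: "g \<in> M\<^sub>t"
    note df = M_tilde_dual[OF f] and dg = M_tilde_dual[OF g]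
    from M_tilde_approx[OF f] M_tilde_approx[OF g] obtain F G where F: "M0_tendsto F f" and G: "M0_tendsto G g"
      by blast
    have m: "F n \<in> M\<^sub>0" "G n \<in> M\<^sub>0" for n using F G by (simp_all add: M0_tendsto_def)
    note FG = ip_tilde_tendsto[OF F G df dg]
    show "ip\<^sub>t f (c *\<^sub>C g) = c *\<^sub>C ip\<^sub>t f g"
    proof (rule LIMSEQ_unique)
      show "(\<lambda>n. ip0 ip (F n) (c *\<^sub>C G n)) \<longlonglongrightarrow> ip\<^sub>t f (c *\<^sub>C g)"
        by (intro ip_tilde_tendsto F M0_tendsto_scaleC G df dg dual_closed)
      show "(\<lambda>n. ip0 ip (F n) (c *\<^sub>C G n)) \<longlonglongrightarrow> c *\<^sub>C ip\<^sub>t f g"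
        using tendsto_scaleC[OF FG, of c] by (simp add: M0.ip_scaleC_right m)
    qed
    show "ip\<^sub>t f (dual_act g a) = ip\<^sub>t f g * a"
    proof (rule LIMSEQ_unique)
      show "(\<lambda>n. ip0 ip (F n) (dual_act (G n) a)) \<longlonglongrightarrow> ip\<^sub>t f (dual_act g a)"
        by (intro ip_tilde_tendsto F M0_tendsto_act G df dg dual_dual_act)
      show "(\<lambda>n. ip0 ip (F n) (dual_act (G n) a)) \<longlonglongrightarrow> ip\<^sub>t f g * a"
        using tendsto_mult[OF FG tendsto_const, of a] by (simp add: M0.ip_act_right m)
    qed
    show "(ip\<^sub>t f g)\<^sup>\<star> = ip\<^sub>t g f"
    proof (rule LIMSEQ_unique)
      show "(\<lambda>n. ip0 ip (G n) (F n)) \<longlonglongrightarrow> ip\<^sub>t g f" by (rule ip_tilde_tendsto[OF G F dg df])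
      show "(\<lambda>n. ip0 ip (G n) (F n)) \<longlonglongrightarrow> (ip\<^sub>t f g)\<^sup>\<star>"
        using tendsto_star[OF FG] by (simp add: ip0_star m)
    qed
    show "ip\<^sub>t f (g + h) = ip\<^sub>t f g + ip\<^sub>t f h" if h: "h \<in> M\<^sub>t"
    proof -
      note dh = M_tilde_dual[OF h]
      from M_tilde_approx[OF h] obtain H where H: "M0_tendsto H h" by blast
      have mh: "H n \<in> M\<^sub>0" for n using H by (simp add: M0_tendsto_def)
      show ?thesis
      proof (rule LIMSEQ_unique)
        show "(\<lambda>n. ip0 ip (F n) (G n + H n)) \<longlonglongrightarrow> ip\<^sub>t f (g + h)"
          by (intro ip_tilde_tendsto F M0_tendsto_add G H df dg dh dual_closed)
        show "(\<lambda>n. ip0 ip (F n) (G n + H n)) \<longlonglongrightarrow> ip\<^sub>t f g + ip\<^sub>t f h"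
          using tendsto_add[OF FG ip_tilde_tendsto[OF F H df dh]] by (simp add: M0.ip_add_right m mh)
      qed
    qed
  next
    fix f assume f: "f \<in> M\<^sub>t"
    from M_tilde_approx[OF f] obtain F where F: "M0_tendsto F f" by blast
    show "positive (ip\<^sub>t f f)"
      by (rule positive_LIMSEQ[OF _ ip_tilde_tendsto[OF F F M_tilde_dual[OF f] M_tilde_dual[OF f]]])
        (use F in \<open>simp add: M0_tendsto_def M0.ip_positive\<close>)
    show "f = 0" if "ip\<^sub>t f f = 0"
      using ip_norm_ip_tilde[OF f] that dual_norm_eq_0[OF M_tilde_dual[OF f]] by (simp add: ip_norm_def)
  qed
qed

text \<open>
  The pointwise limit of the functionals exists because \<open>A\<close> is complete; it is bounded and the convergence is
  uniform on the unit ball.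
\<close>

lemma M_tilde_complete:
  assumes X: "\<And>n. X n \<in> M\<^sub>t"
    and Cauchy: "\<And>e. e > 0 \<Longrightarrow> \<exists>N. \<forall>m\<ge>N. \<forall>n\<ge>N. dnorm (X m - X n) < e"
  shows "\<exists>f\<in>M\<^sub>t. (\<lambda>n. dnorm (X n - f)) \<longlonglongrightarrow> 0"
proof -
  note dX = M_tilde_dual[OF X]
  have dist: "norm (X k m - X n m) \<le> dnorm (X k - X n) * ip_norm ip m" for k n m
    using dual_norm_bound[of "X k - X n" m] by (simp add: dX dual_closed)
  have "convergent (\<lambda>n. X n m)" for m
  proof -
    have "Cauchy (\<lambda>n. X n m)"
    proof (rule CauchyI)
      fix e :: real assume "e > 0"
      then have "e / (ip_norm ip m + 1) > 0" using ip_norm_nonneg[of m] by simp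
      from Cauchy[OF this] obtain N where N: "\<And>k n. k \<ge> N \<Longrightarrow> n \<ge> N \<Longrightarrow> dnorm (X k - X n) < e / (ip_norm ip m + 1)"
        by blast
      have "norm (X k m - X n m) < e" if "k \<ge> N" "n \<ge> N" for k n
      proof -
        have "norm (X k m - X n m) \<le> dnorm (X k - X n) * (ip_norm ip m + 1)"
          using dist[of k m n] dual_norm_nonneg[of "X k - X n"] by (simp add: dX dual_closed distrib_left)
        also have "\<dots> < e"
          using N[OF that] ip_norm_nonneg[of m] by (simp add: field_simps)
        finally show ?thesis .
      qed
      then show "\<exists>N. \<forall>k\<ge>N. \<forall>n\<ge>N. norm (X k m - X n m) < e" by blast
    qed
    then show ?thesis by (simp add: Cauchy_convergent_iff)
  qed
  then obtain f where f: "\<And>m. (\<lambda>n. X n m) \<longlonglongrightarrow> f m" unfolding convergent_def by metis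
  have near: "norm (X n m - f m) \<le> e * ip_norm ip m"
    if "\<And>k. k \<ge> N \<Longrightarrow> dnorm (X n - X k) < e" for n m N e
  proof (rule LIMSEQ_le_const2)
    show "(\<lambda>k. norm (X n m - X k m)) \<longlonglongrightarrow> norm (X n m - f m)" by (intro tendsto_intros f)
    have "norm (X n m - X k m) \<le> e * ip_norm ip m" if "k \<ge> N" for k
      using dist[of n m k] mult_right_mono[OF less_imp_le[OF \<open>\<And>k. k \<ge> N \<Longrightarrow> dnorm (X n - X k) < e\<close>[OF that]] ip_norm_nonneg[of m]]
      by simp
    then show "\<exists>N. \<forall>k\<ge>N. norm (X n m - X k m) \<le> e * ip_norm ip m" by blast
  qed
  have fd: "f \<in> dual"
  proof -
    from Cauchy[of 1] obtain N where N: "\<And>k n. k \<ge> N \<Longrightarrow> n \<ge> N \<Longrightarrow> dnorm (X k - X n) < 1" by auto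
    show ?thesis
    proof (rule dualI)
      show "f (m + n) = f m + f n" for m n
        by (rule LIMSEQ_unique[OF f]) (simp add: dualD(1)[OF dX] tendsto_add f)
      show "f (c *\<^sub>C m) = cnj c *\<^sub>C f m" for c m
        by (rule LIMSEQ_unique[OF f]) (simp add: dualD(2)[OF dX] tendsto_scaleC f)
      show "f (act m a) = a\<^sup>\<star> * f m" for m a
        by (rule LIMSEQ_unique[OF f]) (simp add: dualD(3)[OF dX] tendsto_mult f)
      show "norm (f m) \<le> (dnorm (X N) + 1) * ip_norm ip m" for m
        using norm_triangle_ineq4[of "X N m" "X N m - f m"] dual_norm_bound[OF dX, of N m]
          near[of N N 1 m] N[of N] by (simp add: distrib_right)
    qed
  qed
  have lim: "(\<lambda>n. dnorm (X n - f)) \<longlonglongrightarrow> 0"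
  proof (rule LIMSEQ_I)
    fix e :: real assume e: "e > 0"
    then obtain N where N: "\<And>k n. k \<ge> N \<Longrightarrow> n \<ge> N \<Longrightarrow> dnorm (X k - X n) < e/2"
      using Cauchy[of "e/2"] by auto
    have "dnorm (X n - f) \<le> e/2" if "n \<ge> N" for n
      by (rule dual_norm_le) (use near[of N n "e/2"] N[OF that] e in simp_all)
    then have "norm (dnorm (X n - f) - 0) < e" if "n \<ge> N" for n
      using that e dual_norm_nonneg[of "X n - f"] by (fastforce simp: dX fd dual_closed)
    then show "\<exists>N. \<forall>n\<ge>N. norm (dnorm (X n - f) - 0) < e" by blast
  qed
  have "f \<in> M\<^sub>t"
    unfolding M_tilde_def
  proof (safe)
    fix e :: real assume e: "e > 0"
    from LIMSEQ_D[OF lim half_gt_zero[OF e]] obtain n where "norm (dnorm (X n - f) - 0) < e/2" by blast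
    then have n: "dnorm (X n - f) < e/2" by (simp add: abs_less_iff)
    obtain h where h: "h \<in> M\<^sub>0" "dnorm (X n - h) < e/2"
      using X[of n] e unfolding M_tilde_def by (auto dest: half_gt_zero)
    have "dnorm (f - h) \<le> dnorm (f - X n) + dnorm (X n - h)"
      by (rule dual_norm_triangle_diff[OF fd dX M0_dual[OF h(1)]])
    also have "dnorm (f - X n) = dnorm (X n - f)"
      by (rule dual_norm_minus_commute) (simp add: fd dX dual_closed)
    finally have "dnorm (f - h) < e" using n h(2) by linarith
    with h(1) show "\<exists>g\<in>M\<^sub>0. dnorm (f - g) < e" by blast
  qed (rule fd)
  with lim show ?thesis by blast
qed

lemma M_tilde_hilbert: "hilbert_cstar_module M\<^sub>t dual_act ip\<^sub>t"
proof (rule hilbert_cstar_module.intro[OF M_tilde_inner_product])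
  show "hilbert_cstar_module_axioms M\<^sub>t ip\<^sub>t"
  proof
    fix X :: "nat \<Rightarrow> 'm \<Rightarrow> 'a"
    assume X: "\<And>n. X n \<in> M\<^sub>t"
      and C: "\<And>e. e > 0 \<Longrightarrow> \<exists>N. \<forall>m\<ge>N. \<forall>n\<ge>N. ip_norm ip\<^sub>t (X m - X n) < e"
    have "ip_norm ip\<^sub>t (X m - X n) = dnorm (X m - X n)" for m n
      by (simp add: ip_norm_ip_tilde X M_tilde_closed)
    with C have "\<exists>N. \<forall>m\<ge>N. \<forall>n\<ge>N. dnorm (X m - X n) < e" if "e > 0" for e using that by simp
    from M_tilde_complete[OF X this] obtain f where "f \<in> M\<^sub>t" "(\<lambda>n. dnorm (X n - f)) \<longlonglongrightarrow> 0"
      by blast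
    then show "\<exists>x\<in>M\<^sub>t. (\<lambda>n. ip_norm ip\<^sub>t (X n - x)) \<longlonglongrightarrow> 0"
      by (intro bexI[of _ f]) (simp_all add: ip_norm_ip_tilde X M_tilde_closed)
  qed
qed

text \<open>
  The value \<open>ip' (emb m) h\<close> is forced by multiplying with the elements \<open>x\<close> of an essential ideal for which \<open>h x\<close> lies in
  \<open>M\<close>.  This makes \<open>ip' k h\<close> satisfy the relation that characterises \<open>\<langle>k, h\<rangle>\<close> on \<open>M\<^sub>0\<close>.  The Cauchy-Schwarz inequality
  for \<open>ip'\<close>, whose norm is that of \<open>M'\<close>, carries the equality to the closure.
\<close>

lemma extension_unique:
  assumes I: "inner_product_cstar_module M\<^sub>t dual_act ip'"
    and ext: "\<And>m n. ip' (emb m) (emb n) = ip m n"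
    and nrm: "\<And>f. f \<in> M\<^sub>t \<Longrightarrow> ip_norm ip' f = dnorm f"
    and g: "g \<in> M\<^sub>t" and f: "f \<in> M\<^sub>t"
  shows "ip' g f = ip\<^sub>t g f"
proof -
  interpret I: inner_product_cstar_module "M_tilde act ip" dual_act ip' by (rule I)
  note et = M0_subset_M_tilde[OF emb_M0]
  have left: "ip' (emb m) h = h m" if h: "h \<in> M\<^sub>0" for m h
  proof -
    from M1_ideal[OF M0_M1[OF h]] obtain J where J: "essential_closed_right_ideal J"
      "\<And>x. x \<in> J \<Longrightarrow> \<exists>m. dual_act h x = emb m" by blast
    have "(ip' (emb m) h - h m) * x = 0" if "x \<in> J" for x
    proof -
      from J(2)[OF that] obtain n where n: "dual_act h x = emb n" ..
      have "ip' (emb m) h * x = ip m n"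
        by (simp add: I.ip_act_right[symmetric] et M0_subset_M_tilde h n ext)
      also have "\<dots> = h m * x" using fun_cong[OF n, of m] by (simp add: dual_act_def module_embed_def)
      finally show ?thesis by (simp add: left_diff_distrib)
    qed
    from essential_ideal_cancel[OF J(1) this] show ?thesis by simp
  qed
  have on_M0: "ip' k h = ip0 ip k h" if k: "k \<in> M\<^sub>0" and h: "h \<in> M\<^sub>0" for k h
  proof (rule ip0_eq[symmetric, OF M0_M1[OF h] M0_M1[OF k]])
    show "pairs h k (ip' k h)"
      unfolding pairs_def
    proof (intro allI impI)
      fix x m assume "dual_act k x = emb m"
      then have "h m = ip' (dual_act k x) h" by (simp add: left[OF h])
      then show "h m = x\<^sup>\<star> * ip' k h" by (simp add: I.ip_act_left M0_subset_M_tilde k h)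
    qed
  qed
  from M_tilde_approx[OF g] M_tilde_approx[OF f] obtain G F where G: "M0_tendsto G g" and F: "M0_tendsto F f"
    by blast
  have m: "G n \<in> M\<^sub>0" "F n \<in> M\<^sub>0" for n using F G by (simp_all add: M0_tendsto_def)
  note mt = m[THEN M0_subset_M_tilde]
  have "(\<lambda>n. dnorm (G n - g) * dnorm (F n) + dnorm g * dnorm (F n - f)) \<longlonglongrightarrow> 0 * dnorm f + dnorm g * 0"
    using F G by (intro tendsto_intros dual_norm_tendsto M_tilde_dual f) (simp_all add: M0_tendsto_def)
  then have null: "(\<lambda>n. dnorm (G n - g) * dnorm (F n) + dnorm g * dnorm (F n - f)) \<longlonglongrightarrow> 0" by simp
  have bound: "norm (ip' (G n) (F n) - ip' g f) \<le> dnorm (G n - g) * dnorm (F n) + dnorm g * dnorm (F n - f)" for n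
  proof -
    have d: "G n - g \<in> M\<^sub>t" "F n - f \<in> M\<^sub>t" using mt g f by (simp_all add: M_tilde_closed)
    have "ip' (G n) (F n) - ip' g f = ip' (G n - g) (F n) + ip' g (F n - f)"
      using mt f g by (simp add: I.ip_diff_left I.ip_diff_right)
    then have "norm (ip' (G n) (F n) - ip' g f) \<le> norm (ip' (G n - g) (F n)) + norm (ip' g (F n - f))"
      by (simp add: norm_triangle_ineq)
    also have "\<dots> \<le> dnorm (G n - g) * dnorm (F n) + dnorm g * dnorm (F n - f)"
      using I.cauchy_schwarz[OF d(1) mt(2)[of n]] I.cauchy_schwarz[OF g d(2)] mt g d by (simp add: nrm)
    finally show ?thesis .
  qed
  have "(\<lambda>n. ip' (G n) (F n) - ip' g f) \<longlonglongrightarrow> 0"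
    by (rule Lim_null_comparison[OF _ null]) (simp add: bound)
  then have "(\<lambda>n. ip0 ip (G n) (F n)) \<longlonglongrightarrow> ip' g f" by (simp add: LIM_zero_iff on_M0 m)
  from LIMSEQ_unique[OF this ip_tilde_tendsto[OF G F M_tilde_dual[OF g] M_tilde_dual[OF f]]]
  show ?thesis .
qed

end

theorem theorem7p8:
  fixes act :: "'m::complex_vector \<Rightarrow> 'a::cstar_algebra \<Rightarrow> 'm"
    and ip :: "'m \<Rightarrow> 'm \<Rightarrow> 'a"
  assumes M: "hilbert_cstar_module UNIV act ip"
  shows "hilbert_cstar_module (M_tilde act ip) dual_act (ip_tilde act ip)
    \<and> (\<forall>f \<in> M_tilde act ip. ip_norm (ip_tilde act ip) f = dual_norm ip f)
    \<and> range (module_embed ip) \<subseteq> M_tilde act ip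
    \<and> (\<forall>m n. ip_tilde act ip (module_embed ip m) (module_embed ip n) = ip m n)
    \<and> (\<forall>ip'. inner_product_cstar_module (M_tilde act ip) dual_act ip'
          \<and> (\<forall>m n. ip' (module_embed ip m) (module_embed ip n) = ip m n)
          \<and> (\<forall>f \<in> M_tilde act ip. ip_norm ip' f = dual_norm ip f)
        \<longrightarrow> (\<forall>f \<in> M_tilde act ip. \<forall>g \<in> M_tilde act ip. ip' f g = ip_tilde act ip f g))"
proof -
  interpret hilbert_cstar_module UNIV act ip by (rule M)
  interpret cstar_module_type act ip by unfold_locales
  have "ip_tilde act ip (module_embed ip m) (module_embed ip n) = ip m n" for m n
    by (simp add: ip_tilde_M0 emb_M0 ip0_emb_left) (simp add: module_embed_def)
  moreover have "range (module_embed ip) \<subseteq> M_tilde act ip"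
    using M0_subset_M_tilde[OF emb_M0] by blast
  ultimately show ?thesis
    using M_tilde_hilbert ip_norm_ip_tilde extension_unique by blast
qed

end
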